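(* Let $\mathfrak D=(X,U,\mathbb K,\mathsf T)$ be a cdt-MP, $\Sigma$ a finite alphabet, $\mathsf L:X\to\Sigma$ a Borel measurable labelling map, and let $\mathfrak A=(\mathcal T,\mathsf{Acc})$ be a deterministic $\omega$-automaton over $\Sigma$, with $\mathcal T=(Q,q^s,\Sigma,\mathsf t)$. Let $\hat{\mathfrak D}=\mathfrak D\parallel\mathcal T$ be the composition. Then for every $\alpha\in\mathcal P(X)$ $$\mathsf M^*(\alpha;\mathfrak A)=\hat{\mathsf M}^*(\alpha\otimes\delta_{q^s};H\parallel\mathsf{Acc}),\qquad \mathsf M_*(\alpha;\mathfrak A)=\hat{\mathsf M}_*(\alpha\otimes\delta_{q^s};H\parallel\mathsf{Acc}).$$
   Context: A Borel space is a topological space homeomorphic to a Borel subset of a complete separable metric space; $\mathcal B(Y)$ is its Borel $\sigma$-algebra and $\mathcal P(Y)$ the set of Borel probability measures on $Y$ with the weak topology. A cdt-MP is a tuple $\mathfrak D=(X,U,\mathbb K,\mathsf T)$ with $X,U$ non-empty Borel spaces, $\mathbb K\subseteq X\times U$ an analytic set such that $\mathbb K_x:=\{u\in U:(x,u)\in\mathbb K\}\neq\emptyset$ for all $x\in X$, and $\mathsf T(\cdot|x,u)$ a Borel measurable stochastic kernel on $X$ given $X\times U$. The path space is $H=(X\times U)^{\mathbb N_0}$ and $H_n=(X\times U)^n\times X$ is the space of histories $h_n=(x_0,u_0,\dots,x_{n-1},u_{n-1},x_n)$. A policy is a sequence $\pi=(\pi_n)_{n\ge0}$ of universally measurable stochastic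 kernels $\pi_n$ on $U$ given $H_n$ with $\pi_n(\mathbb K_{x_n}|h_n)=1$ for all $h_n$; $\Pi$ is the set of all policies. For $\alpha\in\mathcal P(X)$ and $\pi\in\Pi$, $\mathsf P^\pi_\alpha$ is the unique probability measure on $H$ under which $x_0\sim\alpha$, the conditional law of $u_n$ given $h_n$ is $\pi_n(\cdot|h_n)$, and the conditional law of $x_{n+1}$ given $(h_n,u_n)$ is $\mathsf T(\cdot|x_n,u_n)$. For $A\in\mathcal B(H)$: $\mathsf M^\pi(\alpha;A)=\mathsf P^\pi_\alpha(A)$, $\mathsf M^*(\alpha;A)=\sup_{\pi\in\Pi}\mathsf M^\pi(\alpha;A)$, $\mathsf M_*(\alpha;A)=\inf_{\pi\in\Pi}\mathsf M^\pi(\alpha;A)$. A deterministic transition system is $\mathcal T=(Q,q^s,\Sigma,\mathsf t)$ with $Q$ finite, $q^s\in Q$, $\mathsf t:Q\times\Sigma\to Q$. Finite sets carry the discrete topology. A word $w\in\Sigma^{\mathbb N_0}$ induces the run $r=\mathsf t_\omega(w)\in Q^{\mathbb N_0}$ with $r_0=q^s$, $r_{k+1}=\mathsf t(r_k,w_k)$. A deterministic $\omega$-automaton is a pair $(\mathcal T,\mathsf{Acc})$ with $\mathsf{Acc}\in\mathcal B(Q^{\mathbb N_0})$; its accepted language is $\mathfrak L(\mathfrak A)=\mathsf t_\omega^{-1}(\mathsf{Acc})$. The trace map is $\mathsf L_\omega(x_0,u_0,x_1,u_1,\dots)=(\mathsf L(x_0),\mathsf L(x_1),\dots)$, and $\mathsf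 M^*(\alpha;\mathfrak A)$, $\mathsf M_*(\alpha;\mathfrak A)$ denote $\mathsf M^*(\alpha;\mathsf L_\omega^{-1}(\mathfrak L(\mathfrak A)))$, $\mathsf M_*(\alpha;\mathsf L_\omega^{-1}(\mathfrak L(\mathfrak A)))$. The composition $\mathfrak D\parallel\mathcal T$ is the cdt-MP $(X\times Q,U,\hat{\mathbb K},\hat{\mathsf T})$ with $\hat{\mathbb K}_{(x,q)}=\mathbb K_x$ and $\hat{\mathsf T}(A\times B|x,q,u)=1_B(\mathsf t(q,\mathsf L(x)))\,\mathsf T(A|x,u)$. Hatted objects ($\hat H$, $\hat\Pi$, $\hat{\mathsf P}$, $\hat{\mathsf M}^*$, $\hat{\mathsf M}_*$) are the corresponding objects for $\hat{\mathfrak D}$. $H\parallel\mathsf{Acc}\subseteq\hat H$ is the set of paths $(x_0,q_0,u_0,x_1,q_1,u_1,\dots)$ with $(q_0,q_1,\dots)\in\mathsf{Acc}$. *)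

theory Defs
  imports "HOL-Probability.Probability"
begin

definition borel_of :: "'a topology \<Rightarrow> 'a measure" where
  "borel_of X = sigma (topspace X) {S. openin X S}"

text \<open>
  The ambient complete separable metric space is taken with carrier in the type of reals. This
  is no restriction: a separable metric space has at most continuum many points, hence
  a homeomorphic copy whose points are real numbers (with an arbitrary topology on them).
\<close>

definition borel_space :: "'a topology \<Rightarrow> bool" where
  "borel_space X \<longleftrightarrow>
     (\<exists>(Y :: real topology) B. completely_metrizable_space Y \<and> separable_space Y \<and>
        B \<in> sets (borel_of Y) \<and> X homeomorphic_space subtopology Y B)"

text \<open>A non-empty analytic set is a continuous image of the Baire space.\<close>

definition analytic_in :: "'a topology \<Rightarrow> 'a set \<Rightarrow> bool" where
  "analytic_in Y A \<longleftrightarrow>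
     A = {} \<or> (\<exists>f :: (nat \<Rightarrow> nat) \<Rightarrow> 'a. continuous_map euclidean Y f \<and> range f = A)"

definition universal_completion :: "'a measure \<Rightarrow> 'a measure" where
  "universal_completion M =
     sigma (space M)
       {A. A \<subseteq> space M \<and> (\<forall>\<mu>\<in>space (prob_algebra M). A \<in> sets (completion \<mu>))}"

record ('x, 'u) mp =
  states :: "'x topology"
  inputs :: "'u topology"
  admissible :: "('x \<times> 'u) set"
  kernel :: "'x \<times> 'u \<Rightarrow> 'x measure"

definition section_at :: "('x, 'u) mp \<Rightarrow> 'x \<Rightarrow> 'u set" where
  "section_at D x = {u \<in> topspace (inputs D). (x, u) \<in> admissible D}"

text \<open>
  The \<open>\<sigma>\<close>-algebra of \<^const>\<open>prob_algebra\<close> is generated by the evaluations \<open>\<mu> \<mapsto> \<mu>(C)\<close>; for a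
  Borel space it is the Borel \<open>\<sigma>\<close>-algebra of the weak topology.
\<close>

definition cdt_mp :: "('x, 'u) mp \<Rightarrow> bool" where
  "cdt_mp D \<longleftrightarrow>
     borel_space (states D) \<and> topspace (states D) \<noteq> {} \<and>
     borel_space (inputs D) \<and> topspace (inputs D) \<noteq> {} \<and>
     analytic_in (prod_topology (states D) (inputs D)) (admissible D) \<and>
     (\<forall>x\<in>topspace (states D). section_at D x \<noteq> {}) \<and>
     kernel D \<in> borel_of (prod_topology (states D) (inputs D))
                  \<rightarrow>\<^sub>M prob_algebra (borel_of (states D))"

definition path_space :: "('x, 'u) mp \<Rightarrow> (nat \<Rightarrow> 'x \<times> 'u) topology" where
  "path_space D = product_topology (\<lambda>_. prod_topology (states D) (inputs D)) UNIV"

definition history_space :: "('x, 'u) mp \<Rightarrow> nat \<Rightarrow> ((nat \<Rightarrow> 'x \<times> 'u) \<times> 'x) topology" where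
  "history_space D n =
     prod_topology (product_topology (\<lambda>_. prod_topology (states D) (inputs D)) {..<n}) (states D)"

definition history :: "nat \<Rightarrow> (nat \<Rightarrow> 'x \<times> 'u) \<Rightarrow> (nat \<Rightarrow> 'x \<times> 'u) \<times> 'x" where
  "history n \<omega> = (restrict \<omega> {..<n}, fst (\<omega> n))"

text \<open>
  A section of an analytic set is universally measurable but in general not Borel, so its
  probability is taken in the completion of \<open>\<pi> n h\<close>.
\<close>

definition policies ::
  "('x, 'u) mp \<Rightarrow> (nat \<Rightarrow> (nat \<Rightarrow> 'x \<times> 'u) \<times> 'x \<Rightarrow> 'u measure) set" where
  "policies D =
     {\<pi>. \<forall>n. \<pi> n \<in> universal_completion (borel_of (history_space D n))
                     \<rightarrow>\<^sub>M prob_algebra (borel_of (inputs D)) \<and>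
             (\<forall>h\<in>topspace (history_space D n).
                emeasure (completion (\<pi> n h)) (section_at D (snd h)) = 1)}"

text \<open>
  The conditional laws are expressed by integration over the conditioning events. The integrand
  \<open>\<pi> n (history n \<omega>)(C)\<close> is only universally measurable in \<open>\<omega>\<close>, hence the completion of \<open>P\<close>.
\<close>

definition is_path_measure ::
  "('x, 'u) mp \<Rightarrow> 'x measure \<Rightarrow> (nat \<Rightarrow> (nat \<Rightarrow> 'x \<times> 'u) \<times> 'x \<Rightarrow> 'u measure) \<Rightarrow>
   (nat \<Rightarrow> 'x \<times> 'u) measure \<Rightarrow> bool" where
  "is_path_measure D \<alpha> \<pi> P \<longleftrightarrow>
     P \<in> space (prob_algebra (borel_of (path_space D))) \<and>
     (\<forall>C\<in>sets (borel_of (states D)). emeasure P {\<omega> \<in> space P. fst (\<omega> 0) \<in> C} = emeasure \<alpha> C) \<and>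
     (\<forall>n. \<forall>B\<in>sets (borel_of (history_space D n)). \<forall>C\<in>sets (borel_of (inputs D)).
        emeasure P {\<omega> \<in> space P. history n \<omega> \<in> B \<and> snd (\<omega> n) \<in> C} =
        (\<integral>\<^sup>+\<omega>\<in>{\<omega>. history n \<omega> \<in> B}. emeasure (\<pi> n (history n \<omega>)) C \<partial>completion P)) \<and>
     (\<forall>n. \<forall>B\<in>sets (borel_of (prod_topology (history_space D n) (inputs D))).
        \<forall>C\<in>sets (borel_of (states D)).
        emeasure P {\<omega> \<in> space P. (history n \<omega>, snd (\<omega> n)) \<in> B \<and> fst (\<omega> (Suc n)) \<in> C} =
        (\<integral>\<^sup>+\<omega>\<in>{\<omega>. (history n \<omega>, snd (\<omega> n)) \<in> B}. emeasure (kernel D (\<omega> n)) C \<partial>P))"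

definition path_measure ::
  "('x, 'u) mp \<Rightarrow> 'x measure \<Rightarrow> (nat \<Rightarrow> (nat \<Rightarrow> 'x \<times> 'u) \<times> 'x \<Rightarrow> 'u measure) \<Rightarrow>
   (nat \<Rightarrow> 'x \<times> 'u) measure" where
  "path_measure D \<alpha> \<pi> = (THE P. is_path_measure D \<alpha> \<pi> P)"

definition M_sup :: "('x, 'u) mp \<Rightarrow> 'x measure \<Rightarrow> (nat \<Rightarrow> 'x \<times> 'u) set \<Rightarrow> ennreal" where
  "M_sup D \<alpha> A = (SUP \<pi>\<in>policies D. emeasure (path_measure D \<alpha> \<pi>) A)"

definition M_inf :: "('x, 'u) mp \<Rightarrow> 'x measure \<Rightarrow> (nat \<Rightarrow> 'x \<times> 'u) set \<Rightarrow> ennreal" where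
  "M_inf D \<alpha> A = (INF \<pi>\<in>policies D. emeasure (path_measure D \<alpha> \<pi>) A)"

record ('q, 's) dts =
  nodes :: "'q set"
  start :: 'q
  alphabet :: "'s set"
  trans :: "'q \<Rightarrow> 's \<Rightarrow> 'q"

definition deterministic_ts :: "('q, 's) dts \<Rightarrow> bool" where
  "deterministic_ts T \<longleftrightarrow>
     finite (nodes T) \<and> start T \<in> nodes T \<and> finite (alphabet T) \<and>
     (\<forall>q\<in>nodes T. \<forall>a\<in>alphabet T. trans T q a \<in> nodes T)"

primrec run :: "('q, 's) dts \<Rightarrow> (nat \<Rightarrow> 's) \<Rightarrow> nat \<Rightarrow> 'q" where
  "run T w 0 = start T"
| "run T w (Suc k) = trans T (run T w k) (w k)"

definition omega_automaton :: "('q, 's) dts \<Rightarrow> (nat \<Rightarrow> 'q) set \<Rightarrow> bool" where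
  "omega_automaton T Acc \<longleftrightarrow>
     deterministic_ts T \<and>
     Acc \<in> sets (borel_of (product_topology (\<lambda>_. discrete_topology (nodes T)) UNIV))"

definition language :: "('q, 's) dts \<Rightarrow> (nat \<Rightarrow> 'q) set \<Rightarrow> (nat \<Rightarrow> 's) set" where
  "language T Acc = {w. (\<forall>n. w n \<in> alphabet T) \<and> run T w \<in> Acc}"

definition trace :: "('x \<Rightarrow> 's) \<Rightarrow> (nat \<Rightarrow> 'x \<times> 'u) \<Rightarrow> nat \<Rightarrow> 's" where
  "trace L \<omega> = (\<lambda>n. L (fst (\<omega> n)))"

definition accepted_paths ::
  "('x, 'u) mp \<Rightarrow> ('x \<Rightarrow> 's) \<Rightarrow> ('q, 's) dts \<Rightarrow> (nat \<Rightarrow> 'q) set \<Rightarrow> (nat \<Rightarrow> 'x \<times> 'u) set" where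
  "accepted_paths D L T Acc =
     {\<omega> \<in> topspace (path_space D). trace L \<omega> \<in> language T Acc}"

definition composition ::
  "('x, 'u) mp \<Rightarrow> ('x \<Rightarrow> 's) \<Rightarrow> ('q, 's) dts \<Rightarrow> ('x \<times> 'q, 'u) mp" where
  "composition D L T =
     \<lparr> states = prod_topology (states D) (discrete_topology (nodes T)),
       inputs = inputs D,
       admissible = {((x, q), u) | x q u. (x, u) \<in> admissible D \<and> q \<in> nodes T},
       kernel = (\<lambda>((x, q), u).
         kernel D (x, u) \<Otimes>\<^sub>M return (borel_of (discrete_topology (nodes T))) (trans T q (L x))) \<rparr>"

definition composed_acceptance ::
  "('x, 'u) mp \<Rightarrow> ('x \<Rightarrow> 's) \<Rightarrow> ('q, 's) dts \<Rightarrow> (nat \<Rightarrow> 'q) set \<Rightarrow> (nat \<Rightarrow> ('x \<times> 'q) \<times> 'u) set" where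
  "composed_acceptance D L T Acc =
     {\<omega> \<in> topspace (path_space (composition D L T)). (\<lambda>n. snd (fst (\<omega> n))) \<in> Acc}"

end

theory Submission
  imports Defs
begin

text \<open>
  The automaton is deterministic and reads only the states of the process, so the composition
  carries no information beyond the process itself: the path \<open>((x\<^sub>n, q\<^sub>n), u\<^sub>n)\<close> of the composition is
  a Borel function \<open>attach_run\<close> of the path \<open>(x\<^sub>n, u\<^sub>n)\<close>, and a history of the composition along a run
  is a Borel function of the history of the process. Composing a policy of the composition with
  this function gives a policy of the process (\<open>pull_back_policy\<close>), and every policy of the process
  arises in this way on its histories, from the policy of the composition that ignores the nodes
  (\<open>push_forward_policy\<close>).

  For corresponding policies the path measure of the composition is the image of the path measure
  of the process under \<open>attach_run\<close> (\<open>path_law_attach_run\<close>). The preimage of the paths with an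
  accepting node sequence is the set of paths with an accepted trace (\<open>attach_run_acceptance\<close>), so
  both sides of each equation are the supremum, or infimum, of the same set of probabilities
  (\<open>attained_values_composition\<close>).

  The path measure is defined by a characterisation, so this argument needs that exactly one
  measure satisfies it. Uniqueness (\<open>path_law_unique\<close>) is an induction over the laws of the
  histories. For existence (\<open>path_law_exists\<close>) the difficulty is that policies are only universally
  measurable, whereas the Ionescu-Tulcea theorem requires Borel kernels. Since the input space has
  a countably generated \<open>\<sigma>\<close>-algebra, a universally measurable kernel agrees with a Borel kernel almost
  surely under any given law of its argument (\<open>kernel_AE_eq_borel_kernel\<close>); replacing the policy at
  each time by a version adapted to the law of the history at that time changes no probability.
\<close>

section \<open>Borel sigma-algebras of second countable spaces\<close>

lemma space_borel_of [simp]: "space (borel_of X) = topspace X"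
  by (simp add: borel_of_def space_measure_of_conv)

lemma openin_subset_Pow: "{S. openin X S} \<subseteq> Pow (topspace X)"
  by (auto dest: openin_subset)

lemma sets_borel_of: "sets (borel_of X) = sigma_sets (topspace X) {S. openin X S}"
  by (simp add: borel_of_def openin_subset_Pow)

lemma openin_in_sets_borel_of: "openin X S \<Longrightarrow> S \<in> sets (borel_of X)"
  by (auto simp: sets_borel_of)

lemma measurable_borel_ofI:
  assumes "continuous_map X Y f"
  shows "f \<in> borel_of X \<rightarrow>\<^sub>M borel_of Y"
proof (rule measurable_sigma_sets[OF sets_borel_of openin_subset_Pow])
  show "f \<in> space (borel_of X) \<rightarrow> topspace Y" using assms by (auto simp: continuous_map_def)
  fix U assume "U \<in> {S. openin Y S}"
  then have "openin X {x \<in> topspace X. f x \<in> U}" using assms by (auto simp: continuous_map_def)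
  moreover have "{x \<in> topspace X. f x \<in> U} = f -` U \<inter> space (borel_of X)" by auto
  ultimately show "f -` U \<inter> space (borel_of X) \<in> sets (borel_of X)"
    by (metis openin_in_sets_borel_of)
qed

lemma sets_borel_of_discrete: "sets (borel_of (discrete_topology A)) = Pow A"
  using sets.sets_into_space[of _ "borel_of (discrete_topology A)"]
  by (auto intro!: openin_in_sets_borel_of)

text \<open>The balls of radius \<open>1 / (n + 1)\<close> around the points of a countable dense set form a base. Second
  countability makes the Borel \<open>\<sigma>\<close>-algebras of products coincide with product \<open>\<sigma>\<close>-algebras and makes
  all of them countably generated.\<close>

lemma separable_metrizable_imp_second_countable:
  assumes "metrizable_space X" "separable_space X"
  shows "second_countable X"
proof -
  from assms(1) obtain M d where Md: "Metric_space M d" and X: "X = Metric_space.mtopology M d"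
    by (auto simp: metrizable_space_def)
  interpret Metric_space M d by (rule Md)
  from assms(2) obtain C where C: "countable C" "C \<subseteq> M" "mtopology closure_of C = M"
    unfolding separable_space_def X by auto
  define \<B> where "\<B> = (\<lambda>(c, n). mball c (1 / Suc n)) ` (C \<times> (UNIV :: nat set))"
  show ?thesis
    unfolding second_countable_def
  proof (intro exI conjI ballI allI impI)
    show "countable \<B>" unfolding \<B>_def using C(1) by auto
    show "openin X V" if "V \<in> \<B>" for V using that by (auto simp: \<B>_def X)
    fix U x assume "openin X U \<and> x \<in> U"
    then obtain r where r: "r > 0" "mball x r \<subseteq> U" and xM: "x \<in> M"
      by (metis X openin_mtopology subsetD)
    \<comment> \<open>Half the radius, because the ball around the dense point must stay inside the ball around \<open>x\<close>.\<close>
    obtain n :: nat where n: "1 / Suc n < r / 2"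
      using r(1) by (metis half_gt_zero inverse_eq_divide reals_Archimedean)
    have "x \<in> mtopology closure_of C" using C(3) xM by simp
    then have "\<forall>r>0. \<exists>y\<in>C. y \<in> mball x r" unfolding metric_closure_of by blast
    moreover have "0 < 1 / real (Suc n)" by simp
    ultimately obtain c where c: "c \<in> C" "c \<in> mball x (1 / Suc n)" by blast
    have "mball c (1 / Suc n) \<subseteq> mball x r"
    proof
      fix y assume y: "y \<in> mball c (1 / Suc n)"
      then have "d x y \<le> d x c + d c y" using c xM by (intro triangle) auto
      also have "\<dots> < r" using y c n by auto
      finally show "y \<in> mball x r" using y xM by auto
    qed
    moreover have "x \<in> mball c (1 / Suc n)" using c by (auto simp: commute)
    moreover have "mball c (1 / Suc n) \<in> \<B>"
      unfolding \<B>_def using c(1) by (intro image_eqI[of _ _ "(c, n)"]) simp_all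
    ultimately show "\<exists>V\<in>\<B>. x \<in> V \<and> V \<subseteq> U" using r(2) by blast
  qed
qed

lemma second_countable_borel_space: "borel_space X \<Longrightarrow> second_countable X"
  unfolding borel_space_def
  by (metis completely_metrizable_imp_metrizable_space homeomorphic_space_second_countability
      separable_metrizable_imp_second_countable second_countable_subtopology)

lemma second_countable_prod_topology:
  assumes "second_countable X" "second_countable Y"
  shows "second_countable (prod_topology X Y)"
proof -
  from assms(1) obtain A where A: "countable A" "\<And>V. V \<in> A \<Longrightarrow> openin X V"
      "\<And>U x. openin X U \<Longrightarrow> x \<in> U \<Longrightarrow> \<exists>V\<in>A. x \<in> V \<and> V \<subseteq> U"
    unfolding second_countable_def by meson
  from assms(2) obtain B where B: "countable B" "\<And>V. V \<in> B \<Longrightarrow> openin Y V"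
      "\<And>U x. openin Y U \<Longrightarrow> x \<in> U \<Longrightarrow> \<exists>V\<in>B. x \<in> V \<and> V \<subseteq> U"
    unfolding second_countable_def by meson
  show ?thesis unfolding second_countable_def
  proof (intro exI conjI ballI allI impI)
    show "countable ((\<lambda>(a, b). a \<times> b) ` (A \<times> B))" using A(1) B(1) by auto
    show "openin (prod_topology X Y) V" if "V \<in> (\<lambda>(a, b). a \<times> b) ` (A \<times> B)" for V
      using that A(2) B(2) by (auto simp: openin_prod_Times_iff)
    fix W z assume "openin (prod_topology X Y) W \<and> z \<in> W"
    then obtain U V where "openin X U" "openin Y V" "fst z \<in> U" "snd z \<in> V" "U \<times> V \<subseteq> W"
      unfolding openin_prod_topology_alt by (metis prod.collapse)
    moreover obtain a b where "a \<in> A" "fst z \<in> a" "a \<subseteq> U" "b \<in> B" "snd z \<in> b" "b \<subseteq> V"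
      using A(3) B(3) calculation by metis
    moreover have "a \<times> b \<in> (\<lambda>(a, b). a \<times> b) ` (A \<times> B)"
      using calculation by (intro image_eqI[of _ _ "(a, b)"]) simp_all
    ultimately show "\<exists>V\<in>(\<lambda>(a, b). a \<times> b) ` (A \<times> B). z \<in> V \<and> V \<subseteq> W"
      by (intro bexI[of _ "a \<times> b"]) (auto simp: mem_Times_iff)
  qed
qed

lemma openin_product_topology_box:
  assumes W: "openin (product_topology X I) W" and z: "z \<in> W"
  obtains U where "finite {i \<in> I. U i \<noteq> topspace (X i)}" "\<And>i. i \<in> I \<Longrightarrow> openin (X i) (U i)"
    "z \<in> Pi\<^sub>E I U" "Pi\<^sub>E I U \<subseteq> W"
proof -
  obtain U where U: "finite {i \<in> I. U i \<noteq> topspace (X i)} \<and> (\<forall>i\<in>I. openin (X i) (U i)) \<and>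
      z \<in> Pi\<^sub>E I U \<and> Pi\<^sub>E I U \<subseteq> W"
    using W[unfolded openin_product_topology_alt, THEN bspec, OF z] by (elim exE)
  show ?thesis by (rule that[of U]) (use U in blast)+
qed

text \<open>The boxes that restrict finitely many coordinates to members of a countable base form a
  countable base of a countable product.\<close>

lemma second_countable_product_topology:
  assumes "second_countable S" "countable I"
  shows "second_countable (product_topology (\<lambda>_. S) I)"
proof -
  from assms obtain A where A: "countable A" "\<And>V. V \<in> A \<Longrightarrow> openin S V"
      "\<And>U x. openin S U \<Longrightarrow> x \<in> U \<Longrightarrow> \<exists>V\<in>A. x \<in> V \<and> V \<subseteq> U"
    unfolding second_countable_def by meson
  define box where "box J F = (\<Pi>\<^sub>E i\<in>I. if i \<in> J then F i else topspace S)" for J and F :: "'b \<Rightarrow> 'a set"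
  define \<B> where "\<B> = (\<Union>J\<in>{J. J \<subseteq> I \<and> finite J}. box J ` (\<Pi>\<^sub>E i\<in>J. A))"
  have ft: "finite {i \<in> I. (if i \<in> J then F i else topspace S) \<noteq> topspace S}" if "finite J" for J F
    by (rule finite_subset[OF _ that]) auto
  show ?thesis unfolding second_countable_def
  proof (intro exI conjI ballI allI impI)
    have "countable {J. J \<subseteq> I \<and> finite J}"
      using countable_Collect_finite_subset[OF assms(2)] by (simp add: conj_commute)
    then show "countable \<B>" unfolding \<B>_def
      using A(1) by (intro countable_UN countable_image countable_PiE) auto
    show "openin (product_topology (\<lambda>_. S) I) V" if "V \<in> \<B>" for V
    proof -
      from that obtain J F where J: "J \<subseteq> I" "finite J" "F \<in> (\<Pi>\<^sub>E i\<in>J. A)" "V = box J F"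
        by (auto simp: \<B>_def)
      then show ?thesis
        unfolding box_def by (auto simp: openin_PiE_gen ft intro!: A(2))
    qed
    fix W z assume "openin (product_topology (\<lambda>_. S) I) W \<and> z \<in> W"
    then have Wz: "openin (product_topology (\<lambda>_. S) I) W" "z \<in> W" by simp_all
    obtain U where U: "finite {i \<in> I. U i \<noteq> topspace S}" "\<And>i. i \<in> I \<Longrightarrow> openin S (U i)"
        "z \<in> Pi\<^sub>E I U" "Pi\<^sub>E I U \<subseteq> W"
      by (rule openin_product_topology_box[OF Wz]) (rule that, simp_all)
    define J where "J = {i \<in> I. U i \<noteq> topspace S}"
    have "\<exists>V\<in>A. z i \<in> V \<and> V \<subseteq> U i" if "i \<in> J" for i
      using that U A(3)[of "U i" "z i"] by (auto simp: J_def PiE_iff)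
    then obtain V where V: "\<And>i. i \<in> J \<Longrightarrow> V i \<in> A \<and> z i \<in> V i \<and> V i \<subseteq> U i"
      by metis
    have "box J (restrict V J) \<subseteq> Pi\<^sub>E I U" unfolding box_def
    proof (rule PiE_mono)
      fix i assume "i \<in> I" then show "(if i \<in> J then restrict V J i else topspace S) \<subseteq> U i"
        using V by (auto simp: J_def)
    qed
    moreover have "z \<in> box J (restrict V J)"
      unfolding box_def
    proof (rule PiE_I)
      fix i assume "i \<in> I"
      then show "z i \<in> (if i \<in> J then restrict V J i else topspace S)"
        using V[of i] PiE_mem[OF U(3), of i] openin_subset[OF U(2)[of i]] by auto
    next
      fix i assume "i \<notin> I" then show "z i = undefined" using U(3) by (rule PiE_arb[rotated])
    qed
    moreover have "box J (restrict V J) \<in> \<B>"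
    proof -
      have "J \<in> {J. J \<subseteq> I \<and> finite J}" using U(1) by (auto simp: J_def)
      moreover have "restrict V J \<in> (\<Pi>\<^sub>E i\<in>J. A)" using V by auto
      ultimately show ?thesis unfolding \<B>_def by blast
    qed
    ultimately show "\<exists>V\<in>\<B>. z \<in> V \<and> V \<subseteq> W"
      using U(4) by (intro bexI[of _ "box J (restrict V J)"]) simp_all
  qed
qed

text \<open>Measurable open neighbourhoods inside every open set are enough for all open sets to be
  measurable: by second countability, countably many of them exhaust a given open set.\<close>

lemma sets_borel_of_subset:
  assumes sc: "second_countable X" and sp: "topspace X = space M"
    and basic: "\<And>U x. openin X U \<Longrightarrow> x \<in> U \<Longrightarrow> \<exists>V. openin X V \<and> V \<in> sets M \<and> x \<in> V \<and> V \<subseteq> U"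
  shows "sets (borel_of X) \<subseteq> sets M"
proof -
  from sc obtain A where A: "countable A" "\<And>V. V \<in> A \<Longrightarrow> openin X V"
      "\<And>U x. openin X U \<Longrightarrow> x \<in> U \<Longrightarrow> \<exists>V\<in>A. x \<in> V \<and> V \<subseteq> U"
    unfolding second_countable_def by meson
  \<comment> \<open>Only the members of the base that fit into a measurable subset of \<open>U\<close> are used, each enlarged to
    such a subset, so that the union stays countable.\<close>
  have "U \<in> sets M" if U: "openin X U" for U
  proof -
    define A' where "A' = {V \<in> A. \<exists>W. W \<in> sets M \<and> V \<subseteq> W \<and> W \<subseteq> U}"
    then have "\<forall>V\<in>A'. \<exists>W. W \<in> sets M \<and> V \<subseteq> W \<and> W \<subseteq> U" by blast
    then obtain w where w: "\<And>V. V \<in> A' \<Longrightarrow> w V \<in> sets M \<and> V \<subseteq> w V \<and> w V \<subseteq> U"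
      by metis
    have "U = (\<Union>V\<in>A'. w V)"
    proof
      show "U \<subseteq> (\<Union>V\<in>A'. w V)"
      proof
        fix x assume "x \<in> U"
        then obtain W where W: "openin X W" "W \<in> sets M" "x \<in> W" "W \<subseteq> U" using basic[OF U] by metis
        then obtain V where "V \<in> A" "x \<in> V" "V \<subseteq> W" using A(3) by metis
        then show "x \<in> (\<Union>V\<in>A'. w V)" using w W unfolding A'_def by blast
      qed
    qed (use w in auto)
    moreover have "(\<Union>V\<in>A'. w V) \<in> sets M"
      using w countable_subset[OF _ A(1), of A'] by (intro sets.countable_UN') (auto simp: A'_def)
    ultimately show ?thesis by simp
  qed
  then show ?thesis
    unfolding sets_borel_of sp by (intro sets.sigma_sets_subset) auto
qed

lemma sets_borel_of_prod_topology:
  assumes "second_countable X" "second_countable Y"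
  shows "sets (borel_of (prod_topology X Y)) = sets (borel_of X \<Otimes>\<^sub>M borel_of Y)"
proof
  show "sets (borel_of (prod_topology X Y)) \<subseteq> sets (borel_of X \<Otimes>\<^sub>M borel_of Y)"
  proof (rule sets_borel_of_subset)
    fix W z assume "openin (prod_topology X Y) W" "z \<in> W"
    then obtain U V where "openin X U" "openin Y V" "fst z \<in> U" "snd z \<in> V" "U \<times> V \<subseteq> W"
      unfolding openin_prod_topology_alt by (metis prod.collapse)
    then show "\<exists>V. openin (prod_topology X Y) V \<and> V \<in> sets (borel_of X \<Otimes>\<^sub>M borel_of Y) \<and> z \<in> V \<and> V \<subseteq> W"
      by (intro exI[of _ "U \<times> V"])
        (auto simp: openin_prod_Times_iff mem_Times_iff intro!: pair_measureI openin_in_sets_borel_of)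
  qed (auto simp: second_countable_prod_topology assms space_pair_measure)
  show "sets (borel_of X \<Otimes>\<^sub>M borel_of Y) \<subseteq> sets (borel_of (prod_topology X Y))"
  proof (rule sets_pair_in_sets)
    fix a b assume a: "a \<in> sets (borel_of X)" and b: "b \<in> sets (borel_of Y)"
    have [measurable]: "fst \<in> borel_of (prod_topology X Y) \<rightarrow>\<^sub>M borel_of X"
        "snd \<in> borel_of (prod_topology X Y) \<rightarrow>\<^sub>M borel_of Y"
      by (auto intro!: measurable_borel_ofI continuous_map_fst continuous_map_snd)
    have "a \<times> b = {z \<in> space (borel_of (prod_topology X Y)). fst z \<in> a \<and> snd z \<in> b}"
      using sets.sets_into_space[OF a] sets.sets_into_space[OF b] by auto
    also have "\<dots> \<in> sets (borel_of (prod_topology X Y))" using a b by measurable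
    finally show "a \<times> b \<in> sets (borel_of (prod_topology X Y))" .
  qed
qed

lemma sets_borel_of_product_topology:
  assumes "second_countable S" "countable I"
  shows "sets (borel_of (product_topology (\<lambda>_. S) I)) = sets (\<Pi>\<^sub>M i\<in>I. borel_of S)"
proof
  let ?T = "product_topology (\<lambda>_. S) I"
  show "sets (borel_of ?T) \<subseteq> sets (\<Pi>\<^sub>M i\<in>I. borel_of S)"
  proof (rule sets_borel_of_subset)
    fix W z assume Wz: "openin ?T W" "z \<in> W"
    obtain U where U: "finite {i \<in> I. U i \<noteq> topspace S}" "\<And>i. i \<in> I \<Longrightarrow> openin S (U i)"
        "z \<in> Pi\<^sub>E I U" "Pi\<^sub>E I U \<subseteq> W"
      by (rule openin_product_topology_box[OF Wz]) (rule that, simp_all)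
    show "\<exists>V. openin ?T V \<and> V \<in> sets (\<Pi>\<^sub>M i\<in>I. borel_of S) \<and> z \<in> V \<and> V \<subseteq> W"
      using U by (intro exI[of _ "Pi\<^sub>E I U"])
        (auto simp: openin_PiE_gen intro!: sets_PiM_I_countable assms openin_in_sets_borel_of)
  qed (auto simp: second_countable_product_topology assms space_PiM)
  show "sets (\<Pi>\<^sub>M i\<in>I. borel_of S) \<subseteq> sets (borel_of ?T)"
  proof (rule sets_PiM_in_sets)
    fix i A assume i: "i \<in> I" and A: "A \<in> sets (borel_of S)"
    have [measurable]: "(\<lambda>x. x i) \<in> borel_of ?T \<rightarrow>\<^sub>M borel_of S"
      using i by (intro measurable_borel_ofI continuous_map_product_projection)
    show "{x \<in> space (borel_of ?T). x i \<in> A} \<in> sets (borel_of ?T)" using A by measurable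
  qed simp
qed

text \<open>Closing a countable base under finite intersections gives a countable \<open>\<pi>\<close>-system, so that
  measurability of a kernel can be tested on countably many events.\<close>

lemma countable_generator_borel_of:
  assumes "second_countable X"
  obtains G where "countable G" "Int_stable G" "G \<subseteq> Pow (topspace X)"
    "sets (borel_of X) = sigma_sets (topspace X) G"
proof -
  from assms obtain A where A: "countable A" "\<And>V. V \<in> A \<Longrightarrow> openin X V"
      "\<And>U x. openin X U \<Longrightarrow> x \<in> U \<Longrightarrow> \<exists>V\<in>A. x \<in> V \<and> V \<subseteq> U"
    unfolding second_countable_def by meson
  define G where "G = (\<lambda>F. topspace X \<inter> \<Inter>F) ` {F. finite F \<and> F \<subseteq> A}"
  have op: "openin X V" if V: "V \<in> G" for V
  proof -
    obtain F where F: "finite F" "F \<subseteq> A" "V = topspace X \<inter> \<Inter>F" using V by (auto simp: G_def)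
    have "openin X (topspace X \<inter> \<Inter>F)" using F(1,2)
    proof (induction F)
      case (insert a F)
      have "topspace X \<inter> \<Inter>(insert a F) = a \<inter> (topspace X \<inter> \<Inter>F)" by auto
      then show ?case using insert A(2) by (auto intro!: openin_Int)
    qed simp
    then show ?thesis by (simp add: F)
  qed
  have AG: "A \<subseteq> G"
  proof
    fix V assume "V \<in> A"
    then show "V \<in> G"
      using openin_subset[OF A(2)[of V]] by (auto simp: G_def intro!: image_eqI[of _ _ "{V}"])
  qed
  have cG: "countable G" unfolding G_def
    using countable_Collect_finite_subset[OF A(1)] by auto
  have Pow: "G \<subseteq> Pow (topspace X)" by (auto simp: G_def)
  have "Int_stable G"
  proof (rule Int_stableI)
    fix a b assume "a \<in> G" "b \<in> G"
    then obtain F F' where "finite F" "F \<subseteq> A" "a = topspace X \<inter> \<Inter>F"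
        "finite F'" "F' \<subseteq> A" "b = topspace X \<inter> \<Inter>F'" by (auto simp: G_def)
    then show "a \<inter> b \<in> G" by (auto simp: G_def intro!: image_eqI[of _ _ "F \<union> F'"])
  qed
  moreover have "sets (borel_of X) = sets (sigma (topspace X) G)"
  proof
    show "sets (borel_of X) \<subseteq> sets (sigma (topspace X) G)"
    proof (rule sets_borel_of_subset[OF assms])
      fix U x assume "openin X U" "x \<in> U"
      then obtain V where "V \<in> A" "x \<in> V" "V \<subseteq> U" using A(3) by metis
      then show "\<exists>V. openin X V \<and> V \<in> sets (sigma (topspace X) G) \<and> x \<in> V \<and> V \<subseteq> U"
        using AG Pow by (intro exI[of _ V]) (auto simp: A(2))
    qed (simp add: space_measure_of_conv)
    show "sets (sigma (topspace X) G) \<subseteq> sets (borel_of X)"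
      unfolding sets_borel_of sets_measure_of[OF Pow]
      by (rule sigma_sets_mono') (auto intro: op)
  qed
  ultimately show ?thesis using that[OF cG _ Pow] Pow by simp
qed

section \<open>Universally measurable kernels\<close>

lemma space_universal_completion [simp]: "space (universal_completion M) = space M"
  by (simp add: universal_completion_def space_measure_of_conv)

lemma universal_completion_cong:
  assumes "sets M = sets N" shows "universal_completion M = universal_completion N"
proof -
  have "space (prob_algebra M) = space (prob_algebra N)"
    using assms by (simp add: space_prob_algebra)
  then show ?thesis
    unfolding universal_completion_def using sets_eq_imp_space_eq[OF assms] by simp
qed

text \<open>For a policy, the measure \<open>\<mu>\<close> will be the law of the history at which the policy is evaluated.\<close>

lemma sets_universal_completion_subset:
  assumes "\<mu> \<in> space (prob_algebra M)"
  shows "sets (universal_completion M) \<subseteq> sets (completion \<mu>)"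
proof -
  have "space \<mu> = space M" using assms by (auto simp: space_prob_algebra dest: sets_eq_imp_space_eq)
  then have "space M \<in> sets (completion \<mu>)" by (metis sets.top sets_completionI_sets)
  moreover have "{A. A \<subseteq> space M \<and> (\<forall>\<mu>\<in>space (prob_algebra M). A \<in> sets (completion \<mu>))}
      \<subseteq> sets (completion \<mu>)" using assms by blast
  ultimately show ?thesis
    unfolding universal_completion_def
    by (subst sets_measure_of) (auto dest: sets.sigma_sets_subset'[THEN subsetD, rotated 2])
qed

lemma measurable_universal_completionD:
  assumes "f \<in> universal_completion M \<rightarrow>\<^sub>M N" "\<mu> \<in> space (prob_algebra M)"
  shows "f \<in> completion \<mu> \<rightarrow>\<^sub>M N"
proof -
  have "space \<mu> = space M" using assms by (auto simp: space_prob_algebra dest: sets_eq_imp_space_eq)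
  then show ?thesis
    using assms(1) sets_universal_completion_subset[OF assms(2)] by (auto simp: measurable_def)
qed

lemma vimage_sets_completion:
  assumes f: "f \<in> \<mu> \<rightarrow>\<^sub>M N" and A: "A \<in> sets (completion (distr \<mu> N f))"
  shows "f -` A \<inter> space \<mu> \<in> sets (completion \<mu>)"
proof -
  from A obtain S Z Z' where *: "A = S \<union> Z" "Z \<subseteq> Z'" "Z' \<in> null_sets (distr \<mu> N f)" "S \<in> sets (distr \<mu> N f)"
    by (rule sets_completionE)
  show ?thesis
  proof (rule sets_completionI)
    show "f -` A \<inter> space \<mu> = (f -` S \<inter> space \<mu>) \<union> (f -` Z \<inter> space \<mu>)" using * by auto
    show "f -` Z \<inter> space \<mu> \<subseteq> f -` Z' \<inter> space \<mu>" using * by auto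
    show "f -` Z' \<inter> space \<mu> \<in> null_sets \<mu>" using * f by (simp add: null_sets_distr_iff)
    show "f -` S \<inter> space \<mu> \<in> sets \<mu>" using * f by auto
  qed
qed

text \<open>Universal measurability survives composition with a Borel map because the preimage of a null
  set is null for the measure whose image is taken.\<close>

lemma measurable_universal_completion:
  assumes f: "f \<in> M \<rightarrow>\<^sub>M N"
  shows "f \<in> universal_completion M \<rightarrow>\<^sub>M universal_completion N"
  unfolding universal_completion_def[of N]
proof (rule measurable_measure_of)
  show "f \<in> space (universal_completion M) \<rightarrow> space N" using f by (auto simp: measurable_def)
  fix A assume A: "A \<in> {A. A \<subseteq> space N \<and> (\<forall>\<mu>\<in>space (prob_algebra N). A \<in> sets (completion \<mu>))}"
  have "f -` A \<inter> space M \<in> sets (completion \<mu>)" if \<mu>: "\<mu> \<in> space (prob_algebra M)" for \<mu>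
  proof -
    have s: "sets \<mu> = sets M" and p: "prob_space \<mu>" using \<mu> by (auto simp: space_prob_algebra)
    have f': "f \<in> \<mu> \<rightarrow>\<^sub>M N" using f by (simp cong: measurable_cong_sets add: s)
    then have "distr \<mu> N f \<in> space (prob_algebra N)"
      using p by (auto simp: space_prob_algebra intro: prob_space.prob_space_distr)
    then have "A \<in> sets (completion (distr \<mu> N f))" using A by auto
    then show ?thesis
      using vimage_sets_completion[OF f'] sets_eq_imp_space_eq[OF s] by simp
  qed
  then show "f -` A \<inter> space (universal_completion M) \<in> sets (universal_completion M)"
    unfolding universal_completion_def[of M] by (auto simp: space_measure_of_conv)
qed auto

text \<open>A completion-measurable integrand agrees almost everywhere with a Borel one, for which this is
  the usual change of variables.\<close>

lemma nn_integral_completion_distr: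
  assumes X: "X \<in> P \<rightarrow>\<^sub>M N" and f: "f \<in> borel_measurable (completion (distr P N X))"
  shows "(\<integral>\<^sup>+\<omega>. f (X \<omega>) \<partial>completion P) = (\<integral>\<^sup>+x. f x \<partial>completion (distr P N X))"
proof -
  obtain g where g: "g \<in> borel_measurable N" and ae: "AE x in distr P N X. f x = g x"
    using completion_ex_borel_measurable[OF f] by auto
  have "AE \<omega> in P. f (X \<omega>) = g (X \<omega>)" using AE_distrD[OF X ae] .
  then have "(\<integral>\<^sup>+\<omega>. f (X \<omega>) \<partial>completion P) = (\<integral>\<^sup>+\<omega>. g (X \<omega>) \<partial>P)"
    unfolding nn_integral_completion by (rule nn_integral_cong_AE)
  also have "\<dots> = (\<integral>\<^sup>+x. g x \<partial>distr P N X)"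
    using X g by (simp add: nn_integral_distr)
  also have "\<dots> = (\<integral>\<^sup>+x. f x \<partial>completion (distr P N X))"
    unfolding nn_integral_completion using ae by (intro nn_integral_cong_AE) auto
  finally show ?thesis .
qed

text \<open>On a countably generated space only countably many events have to be corrected, and the
  exceptional null sets of countably many events can be united.\<close>

lemma kernel_AE_eq_borel_kernel:
  assumes f: "f \<in> completion \<mu> \<rightarrow>\<^sub>M prob_algebra N"
    and G: "countable G" "Int_stable G" "G \<subseteq> Pow (space N)" "sets N = sigma_sets (space N) G"
    and N: "space N \<noteq> {}"
  obtains g where "g \<in> \<mu> \<rightarrow>\<^sub>M prob_algebra N" "AE x in \<mu>. f x = g x"
proof -
  have fx: "prob_space (f x)" "sets (f x) = sets N" if "x \<in> space \<mu>" for x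
    using measurable_space[OF f] that by (auto simp: space_prob_algebra)
  have GN: "C \<in> G \<Longrightarrow> C \<in> sets N" for C using G(4) by auto
  have "\<exists>h\<in>borel_measurable \<mu>. AE x in \<mu>. emeasure (f x) C = h x" if "C \<in> G" for C
  proof (rule completion_ex_borel_measurable)
    show "(\<lambda>x. emeasure (f x) C) \<in> borel_measurable (completion \<mu>)"
      using measurable_prob_algebraD[OF f] GN[OF that] by measurable
  qed
  then obtain h where h: "\<And>C. C \<in> G \<Longrightarrow> h C \<in> borel_measurable \<mu>"
      "\<And>C. C \<in> G \<Longrightarrow> AE x in \<mu>. emeasure (f x) C = h C x"
    by metis
  have "AE x in \<mu>. \<forall>C\<in>G. emeasure (f x) C = h C x"
    using h(2) G(1) by (simp add: AE_ball_countable)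
  then obtain Z where Z: "Z \<in> null_sets \<mu>"
      "{x\<in>space \<mu>. \<not> (\<forall>C\<in>G. emeasure (f x) C = h C x)} \<subseteq> Z"
    by (auto simp: eventually_ae_filter)
  obtain y where y: "y \<in> space N" using N by auto
  define g where "g x = (if x \<in> Z then return N y else f x)" for x
  have Zs [measurable]: "Z \<in> sets \<mu>" using Z by auto
  have "g \<in> \<mu> \<rightarrow>\<^sub>M prob_algebra N"
  proof (rule measurable_prob_algebra_generated[OF G(4,2,3)])
    fix x assume "x \<in> space \<mu>"
    then show "prob_space (g x)" "sets (g x) = sets N"
      using fx y by (auto simp: g_def prob_space_return)
  next
    fix C assume C: "C \<in> G"
    have "(\<lambda>x. emeasure (g x) C) \<in> borel_measurable \<mu> \<longleftrightarrow>
        (\<lambda>x. if x \<in> Z then indicator C y else h C x) \<in> borel_measurable \<mu>"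
      using Z(2) GN[OF C] C by (intro measurable_cong) (auto simp: g_def)
    also have "\<dots>" using h(1)[OF C] by measurable
    finally show "(\<lambda>x. emeasure (g x) C) \<in> borel_measurable \<mu>" .
  qed
  moreover have "AE x in \<mu>. f x = g x"
    using AE_not_in[OF Z(1)] by eventually_elim (auto simp: g_def)
  ultimately show ?thesis by (rule that)
qed

lemma measure_eqI_rectangles:
  assumes "sets P = sets (A \<Otimes>\<^sub>M B)" "sets Q = sets (A \<Otimes>\<^sub>M B)" "finite_measure P"
    and eq: "\<And>a b. a \<in> sets A \<Longrightarrow> b \<in> sets B \<Longrightarrow> emeasure P (a \<times> b) = emeasure Q (a \<times> b)"
  shows "P = Q"
proof (rule measure_eqI_generator_eq)
  interpret finite_measure P by fact
  show "Int_stable {a \<times> b | a b. a \<in> sets A \<and> b \<in> sets B}" by (rule Int_stable_pair_measure_generator)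
  show "{a \<times> b | a b. a \<in> sets A \<and> b \<in> sets B} \<subseteq> Pow (space A \<times> space B)"
    by (rule pair_measure_closed)
  show "sets P = sigma_sets (space A \<times> space B) {a \<times> b | a b. a \<in> sets A \<and> b \<in> sets B}"
    "sets Q = sigma_sets (space A \<times> space B) {a \<times> b | a b. a \<in> sets A \<and> b \<in> sets B}"
    using assms by (simp_all add: sets_pair_measure)
  show "range (\<lambda>_::nat. space A \<times> space B) \<subseteq> {a \<times> b | a b. a \<in> sets A \<and> b \<in> sets B}" by auto
  show "emeasure P (space A \<times> space B) \<noteq> \<infinity>" for i :: nat by simp
qed (use eq in auto)

lemma pair_measure_return:
  assumes "prob_space M" "q \<in> space N"
  shows "M \<Otimes>\<^sub>M return N q = distr M (M \<Otimes>\<^sub>M N) (\<lambda>x. (x, q))"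
proof -
  interpret M: prob_space M by fact
  interpret R: prob_space "return N q" using assms(2) by (rule prob_space_return)
  interpret pair_prob_space M "return N q" ..
  show ?thesis
  proof (rule measure_eqI_rectangles[of _ M N])
    fix a b assume [measurable]: "a \<in> sets M" "b \<in> sets N"
    have "(\<lambda>x. (x, q)) -` (a \<times> b) \<inter> space M = (if q \<in> b then a else {})"
      using sets.sets_into_space[of a M] by auto
    then show "emeasure (M \<Otimes>\<^sub>M return N q) (a \<times> b) = emeasure (distr M (M \<Otimes>\<^sub>M N) (\<lambda>x. (x, q))) (a \<times> b)"
      using assms(2) by (simp add: emeasure_distr R.emeasure_pair_measure_Times)
  qed (auto intro!: sets_pair_measure_cong finite_measure)
qed

section \<open>Strategic measures\<close>

lemma bind_in_space_prob_algebra: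
  assumes "A \<in> space (prob_algebra M)" "B \<in> M \<rightarrow>\<^sub>M prob_algebra N"
  shows "A \<bind> B \<in> space (prob_algebra N)"
  using prob_space_bind'[OF assms] sets_bind'[OF assms] by (simp add: space_prob_algebra)

lemma nn_integral_bind_prob_algebra:
  assumes "A \<in> space (prob_algebra M)" "B \<in> M \<rightarrow>\<^sub>M prob_algebra N" "f \<in> borel_measurable N"
  shows "(\<integral>\<^sup>+y. f y \<partial>(A \<bind> B)) = (\<integral>\<^sup>+x. \<integral>\<^sup>+y. f y \<partial>B x \<partial>A)"
proof (rule nn_integral_bind[OF assms(3)])
  have "sets A = sets M" using assms(1) by (simp add: space_prob_algebra)
  then show "B \<in> A \<rightarrow>\<^sub>M subprob_algebra N"
    using measurable_prob_algebraD[OF assms(2)] by (simp cong: measurable_cong_sets)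
qed

text \<open>The properties of a cdt-MP on which the construction of its strategic measures rests. They pass
  directly to the composition, so that existence and uniqueness are available for both processes
  from a single development.\<close>

locale countable_mp =
  fixes D :: "('x, 'u) mp"
  assumes second_countable_states: "second_countable (states D)"
    and second_countable_inputs: "second_countable (inputs D)"
    and inputs_nonempty: "topspace (inputs D) \<noteq> {}"
    and kernel_measurable_borel: "kernel D \<in> borel_of (prod_topology (states D) (inputs D))
          \<rightarrow>\<^sub>M prob_algebra (borel_of (states D))"
begin

abbreviation MX :: "'x measure" where "MX \<equiv> borel_of (states D)"
abbreviation MU :: "'u measure" where "MU \<equiv> borel_of (inputs D)"
abbreviation MP :: "('x \<times> 'u) measure" where "MP \<equiv> MX \<Otimes>\<^sub>M MU"
abbreviation MB :: "nat \<Rightarrow> (nat \<Rightarrow> 'x \<times> 'u) measure" where "MB n \<equiv> PiM {..<n} (\<lambda>_. MP)"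
abbreviation MH :: "nat \<Rightarrow> ((nat \<Rightarrow> 'x \<times> 'u) \<times> 'x) measure" where "MH n \<equiv> MB n \<Otimes>\<^sub>M MX"
abbreviation MW :: "(nat \<Rightarrow> 'x \<times> 'u) measure" where "MW \<equiv> PiM UNIV (\<lambda>_. MP)"

lemma sets_borel_pair: "sets (borel_of (prod_topology (states D) (inputs D))) = sets MP"
  by (intro sets_borel_of_prod_topology second_countable_states second_countable_inputs)

lemma second_countable_pair: "second_countable (prod_topology (states D) (inputs D))"
  by (intro second_countable_prod_topology second_countable_states second_countable_inputs)

lemma sets_borel_product:
  assumes "countable I"
  shows "sets (borel_of (product_topology (\<lambda>_. prod_topology (states D) (inputs D)) I)) =
    sets (PiM I (\<lambda>_. MP))"
  unfolding sets_borel_of_product_topology[OF second_countable_pair assms]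
  by (rule sets_PiM_cong) (auto simp: sets_borel_pair)

lemma sets_borel_path_space: "sets (borel_of (path_space D)) = sets MW"
  unfolding path_space_def by (rule sets_borel_product) simp

lemma second_countable_history_space: "second_countable (history_space D n)"
  unfolding history_space_def
  by (intro second_countable_prod_topology second_countable_product_topology second_countable_pair
      second_countable_states) auto

lemma sets_borel_history_space: "sets (borel_of (history_space D n)) = sets (MH n)"
proof -
  have "sets (borel_of (history_space D n)) = sets (borel_of (product_topology
      (\<lambda>_. prod_topology (states D) (inputs D)) {..<n}) \<Otimes>\<^sub>M MX)"
    unfolding history_space_def
    by (intro sets_borel_of_prod_topology second_countable_product_topology second_countable_pair
        second_countable_states) auto
  also have "\<dots> = sets (MH n)"
    by (intro sets_pair_measure_cong sets_borel_product) auto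
  finally show ?thesis .
qed

lemma sets_borel_history_input:
  "sets (borel_of (prod_topology (history_space D n) (inputs D))) = sets (MH n \<Otimes>\<^sub>M MU)"
  by (subst sets_borel_of_prod_topology)
     (auto intro!: second_countable_history_space second_countable_inputs sets_pair_measure_cong
        simp: sets_borel_history_space)

lemma topspace_path_space: "topspace (path_space D) = space MW"
  using sets_eq_imp_space_eq[OF sets_borel_path_space] by simp

lemma topspace_history_space: "topspace (history_space D n) = space (MH n)"
  using sets_eq_imp_space_eq[OF sets_borel_history_space] by simp

lemma kernel_measurable [measurable]: "kernel D \<in> MP \<rightarrow>\<^sub>M prob_algebra MX"
  using kernel_measurable_borel sets_borel_pair by (simp cong: measurable_cong_sets)

lemma history_measurable [measurable]: "history n \<in> MW \<rightarrow>\<^sub>M MH n"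
  unfolding history_def by measurable

lemma policy_measurable:
  assumes "\<pi> \<in> policies D"
  shows "\<pi> n \<in> universal_completion (MH n) \<rightarrow>\<^sub>M prob_algebra MU"
proof -
  have "\<pi> n \<in> universal_completion (borel_of (history_space D n)) \<rightarrow>\<^sub>M prob_algebra MU"
    using assms by (simp add: policies_def)
  then show ?thesis unfolding universal_completion_cong[OF sets_borel_history_space] .
qed

text \<open>The three defining conditions in terms of product \<open>\<sigma>\<close>-algebras, in which measurability of
  concrete maps can be proved componentwise.\<close>

lemma is_path_measure_iff:
  "is_path_measure D \<alpha> \<pi> P \<longleftrightarrow>
     sets P = sets MW \<and> prob_space P \<and>
     (\<forall>C\<in>sets MX. emeasure P {\<omega> \<in> space MW. fst (\<omega> 0) \<in> C} = emeasure \<alpha> C) \<and>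
     (\<forall>n. \<forall>B\<in>sets (MH n). \<forall>C\<in>sets MU.
        emeasure P {\<omega> \<in> space MW. history n \<omega> \<in> B \<and> snd (\<omega> n) \<in> C} =
        (\<integral>\<^sup>+\<omega>. emeasure (\<pi> n (history n \<omega>)) C * indicator B (history n \<omega>) \<partial>completion P)) \<and>
     (\<forall>n. \<forall>B\<in>sets (MH n \<Otimes>\<^sub>M MU). \<forall>C\<in>sets MX.
        emeasure P {\<omega> \<in> space MW. (history n \<omega>, snd (\<omega> n)) \<in> B \<and> fst (\<omega> (Suc n)) \<in> C} =
        (\<integral>\<^sup>+\<omega>. emeasure (kernel D (\<omega> n)) C * indicator B (history n \<omega>, snd (\<omega> n)) \<partial>P))"
proof -
  have 1: "indicator {\<omega>. history n \<omega> \<in> B} \<omega> = (indicator B (history n \<omega>) :: ennreal)"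
    for n B and \<omega> :: "nat \<Rightarrow> 'x \<times> 'u" by (simp add: indicator_def)
  have 2: "indicator {\<omega>. (history n \<omega>, snd (\<omega> n)) \<in> B} \<omega> = (indicator B (history n \<omega>, snd (\<omega> n)) :: ennreal)"
    for n B and \<omega> :: "nat \<Rightarrow> 'x \<times> 'u" by (simp add: indicator_def)
  show ?thesis
    unfolding is_path_measure_def sets_borel_history_input sets_borel_history_space 1 2
    by (auto simp: space_prob_algebra sets_borel_path_space dest: sets_eq_imp_space_eq)
qed

subsection \<open>Uniqueness\<close>

text \<open>A cylinder depends on finitely many coordinates, so it is the preimage of a measurable set of
  histories; cylinders form a generating \<open>\<pi>\<close>-system.\<close>

lemma path_law_determined_by_histories:
  assumes "sets P = sets MW" "sets Q = sets MW" "prob_space P"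
    and eq: "\<And>n. distr P (MH n) (history n) = distr Q (MH n) (history n)"
  shows "P = Q"
proof (rule measure_eqI_PiM_infinite[OF assms(1,2)])
  interpret prob_space P by fact
  show "finite_measure P" by (rule finite_measure_axioms)
  fix A and J :: "nat set" assume J: "finite J" and A: "\<And>i. i \<in> J \<Longrightarrow> A i \<in> sets MP"
  obtain n where n: "J \<subseteq> {..<n}" using J by (metis finite_nat_bounded)
  define B where "B = {h \<in> space (MH n). \<forall>i\<in>J. fst h i \<in> A i}"
  have "{h \<in> space (MH n). fst h i \<in> A i} \<in> sets (MH n)" if "i \<in> J" for i
  proof -
    have "(\<lambda>h. fst h i) \<in> MH n \<rightarrow>\<^sub>M MP" using that n by (intro measurable_compose[OF measurable_fst]) auto
    then show ?thesis using A[OF that] by measurable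
  qed
  then have B: "B \<in> sets (MH n)" unfolding B_def using J by (intro sets.sets_Collect_finite_All) auto
  have "prod_emb UNIV (\<lambda>_. MP) J (Pi\<^sub>E J A) = history n -` B \<inter> space MW"
  proof
    show "prod_emb UNIV (\<lambda>_. MP) J (Pi\<^sub>E J A) \<subseteq> history n -` B \<inter> space MW"
    proof
      fix \<omega> assume w: "\<omega> \<in> prod_emb UNIV (\<lambda>_. MP) J (Pi\<^sub>E J A)"
      then have sp: "\<omega> \<in> space MW" by (auto simp: prod_emb_def space_PiM)
      have "\<And>i. i \<in> J \<Longrightarrow> \<omega> i \<in> A i" using w by (auto simp: prod_emb_def PiE_iff)
      then show "\<omega> \<in> history n -` B \<inter> space MW"
        using n sp measurable_space[OF history_measurable sp] by (auto simp: B_def history_def)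
    qed
    show "history n -` B \<inter> space MW \<subseteq> prod_emb UNIV (\<lambda>_. MP) J (Pi\<^sub>E J A)"
      using n by (auto simp: B_def history_def prod_emb_def space_PiM PiE_iff subset_iff)
  qed
  moreover have "emeasure P (history n -` B \<inter> space MW) = emeasure Q (history n -` B \<inter> space MW)"
  proof -
    have "emeasure R (history n -` B \<inter> space MW) = emeasure (distr R (MH n) (history n)) B"
      if "sets R = sets MW" for R
      using B that sets_eq_imp_space_eq[OF that]
      by (subst emeasure_distr) (auto cong: measurable_cong_sets)
    then show ?thesis using assms(1,2) eq by metis
  qed
  ultimately show "emeasure P (prod_emb UNIV (\<lambda>_. MP) J (Pi\<^sub>E J A)) =
      emeasure Q (prod_emb UNIV (\<lambda>_. MP) J (Pi\<^sub>E J A))" by simp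
qed

definition extend_history :: "nat \<Rightarrow> (((nat \<Rightarrow> 'x \<times> 'u) \<times> 'x) \<times> 'u) \<times> 'x \<Rightarrow> (nat \<Rightarrow> 'x \<times> 'u) \<times> 'x" where
  "extend_history n = (\<lambda>(((p, x), u), y). (p(n := (x, u)), y))"

lemma extend_history_measurable [measurable]:
  "extend_history n \<in> (MH n \<Otimes>\<^sub>M MU) \<Otimes>\<^sub>M MX \<rightarrow>\<^sub>M MH (Suc n)"
proof -
  have [measurable]: "(\<lambda>z. (fst (fst (fst z)))(n := (snd (fst (fst z)), snd (fst z))))
      \<in> (MH n \<Otimes>\<^sub>M MU) \<Otimes>\<^sub>M MX \<rightarrow>\<^sub>M MB (Suc n)"
    by (rule measurable_fun_upd[of _ "{..<n}"]) (auto simp: lessThan_Suc)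
  have "extend_history n = (\<lambda>z. ((fst (fst (fst z)))(n := (snd (fst (fst z)), snd (fst z))), snd z))"
    by (auto simp: extend_history_def fun_eq_iff)
  then show ?thesis by simp
qed

lemma history_Suc:
  "history (Suc n) \<omega> = extend_history n ((history n \<omega>, snd (\<omega> n)), fst (\<omega> (Suc n)))"
  by (auto simp: extend_history_def history_def fun_eq_iff)

text \<open>By induction on \<open>n\<close> the law of the history at time \<open>n\<close> is the same for both measures. It
  determines the joint law with the input \<open>u\<^sub>n\<close>, because the integral in the second condition depends
  on the path measure only through the law of the history, and by the third condition this joint
  law determines the one with the next state.\<close>

lemma path_law_unique:
  assumes \<pi>: "\<And>n. \<pi> n \<in> universal_completion (MH n) \<rightarrow>\<^sub>M prob_algebra MU"
    and P: "is_path_measure D \<alpha> \<pi> P" and Q: "is_path_measure D \<alpha> \<pi> Q"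
  shows "P = Q"
proof -
  have sP [measurable_cong]: "sets P = sets MW" and sQ [measurable_cong]: "sets Q = sets MW"
    and pP: "prob_space P" and pQ: "prob_space Q"
    using P Q by (auto simp: is_path_measure_iff)
  have spP: "space P = space MW" and spQ: "space Q = space MW"
    using sP sQ by (auto dest: sets_eq_imp_space_eq)
  have fin: "finite_measure (distr P N f)" if "f \<in> P \<rightarrow>\<^sub>M N" for N f
    using prob_space.prob_space_distr[OF pP that] by (simp add: prob_space_def)
  have "distr P (MH n) (history n) = distr Q (MH n) (history n)" for n
  proof (induction n)
    case 0
    show ?case
    proof (rule measure_eqI_rectangles[of _ "MB 0" MX])
      fix a b assume a: "a \<in> sets (MB 0)" and b: "b \<in> sets MX"
      have "emeasure (distr R (MH 0) (history 0)) (a \<times> b) = (if a = {} then 0 else emeasure \<alpha> b)"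
        if R: "is_path_measure D \<alpha> \<pi> R" for R
      proof -
        have sR [measurable_cong]: "sets R = sets MW" and spR: "space R = space MW"
          using R by (auto simp: is_path_measure_iff dest: sets_eq_imp_space_eq)
        have "a = {} \<or> a = {\<lambda>_. undefined}"
          using sets.sets_into_space[OF a] by (auto simp: space_PiM)
        then have "history 0 -` (a \<times> b) \<inter> space R = (if a = {} then {} else {\<omega> \<in> space MW. fst (\<omega> 0) \<in> b})"
          by (auto simp: history_def spR restrict_def)
        then show ?thesis
          using R a b by (subst emeasure_distr) (auto simp: is_path_measure_iff simp del: lessThan_0)
      qed
      then show "emeasure (distr P (MH 0) (history 0)) (a \<times> b) = emeasure (distr Q (MH 0) (history 0)) (a \<times> b)"
        using P Q by simp
    qed (auto intro!: fin simp del: lessThan_0)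
  next
    case (Suc n)
    let ?hu = "\<lambda>\<omega>. (history n \<omega>, snd (\<omega> n))"
    have hu: "distr P (MH n \<Otimes>\<^sub>M MU) ?hu = distr Q (MH n \<Otimes>\<^sub>M MU) ?hu"
    proof (rule measure_eqI_rectangles[of _ "MH n" MU])
      fix B C assume B [measurable]: "B \<in> sets (MH n)" and C [measurable]: "C \<in> sets MU"
      have "emeasure (distr R (MH n \<Otimes>\<^sub>M MU) ?hu) (B \<times> C) =
          (\<integral>\<^sup>+h. emeasure (\<pi> n h) C * indicator B h \<partial>completion (distr R (MH n) (history n)))"
        if R: "is_path_measure D \<alpha> \<pi> R" for R
      proof -
        have sR [measurable_cong]: "sets R = sets MW" and spR: "space R = space MW" and pR: "prob_space R"
          using R by (auto simp: is_path_measure_iff dest: sets_eq_imp_space_eq)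
        have "distr R (MH n) (history n) \<in> space (prob_algebra (MH n))"
          using pR by (auto simp: space_prob_algebra intro!: prob_space.prob_space_distr)
        from measurable_universal_completionD[OF \<pi> this]
        have [measurable]: "\<pi> n \<in> completion (distr R (MH n) (history n)) \<rightarrow>\<^sub>M subprob_algebra MU"
          by (rule measurable_prob_algebraD)
        have [measurable]: "B \<in> sets (completion (distr R (MH n) (history n)))"
          using B by (intro sets_completionI_sets) simp
        have "?hu -` (B \<times> C) \<inter> space R = {\<omega> \<in> space MW. history n \<omega> \<in> B \<and> snd (\<omega> n) \<in> C}"
          by (auto simp: spR)
        then have "emeasure (distr R (MH n \<Otimes>\<^sub>M MU) ?hu) (B \<times> C) =
            (\<integral>\<^sup>+\<omega>. emeasure (\<pi> n (history n \<omega>)) C * indicator B (history n \<omega>) \<partial>completion R)"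
          using R B C by (subst emeasure_distr) (auto simp: is_path_measure_iff)
        also have "\<dots> = (\<integral>\<^sup>+h. emeasure (\<pi> n h) C * indicator B h \<partial>completion (distr R (MH n) (history n)))"
          by (rule nn_integral_completion_distr) measurable
        finally show ?thesis .
      qed
      then show "emeasure (distr P (MH n \<Otimes>\<^sub>M MU) ?hu) (B \<times> C) = emeasure (distr Q (MH n \<Otimes>\<^sub>M MU) ?hu) (B \<times> C)"
        using P Q Suc.IH by simp
    qed (auto intro!: fin)
    let ?hux = "\<lambda>\<omega>. (?hu \<omega>, fst (\<omega> (Suc n)))"
    have "distr P ((MH n \<Otimes>\<^sub>M MU) \<Otimes>\<^sub>M MX) ?hux = distr Q ((MH n \<Otimes>\<^sub>M MU) \<Otimes>\<^sub>M MX) ?hux"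
    proof (rule measure_eqI_rectangles[of _ "MH n \<Otimes>\<^sub>M MU" MX])
      fix B C assume B [measurable]: "B \<in> sets (MH n \<Otimes>\<^sub>M MU)" and C [measurable]: "C \<in> sets MX"
      have "emeasure (distr R ((MH n \<Otimes>\<^sub>M MU) \<Otimes>\<^sub>M MX) ?hux) (B \<times> C) =
          (\<integral>\<^sup>+z. emeasure (kernel D (snd (fst z), snd z)) C * indicator B z \<partial>distr R (MH n \<Otimes>\<^sub>M MU) ?hu)"
        if R: "is_path_measure D \<alpha> \<pi> R" for R
      proof -
        have sR [measurable_cong]: "sets R = sets MW" and spR: "space R = space MW"
          using R by (auto simp: is_path_measure_iff dest: sets_eq_imp_space_eq)
        have [measurable]: "kernel D \<in> MP \<rightarrow>\<^sub>M subprob_algebra MX"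
          by (rule measurable_prob_algebraD[OF kernel_measurable])
        have "?hux -` (B \<times> C) \<inter> space R = {\<omega> \<in> space MW. ?hu \<omega> \<in> B \<and> fst (\<omega> (Suc n)) \<in> C}"
          by (auto simp: spR)
        then have "emeasure (distr R ((MH n \<Otimes>\<^sub>M MU) \<Otimes>\<^sub>M MX) ?hux) (B \<times> C) =
            (\<integral>\<^sup>+\<omega>. emeasure (kernel D (\<omega> n)) C * indicator B (?hu \<omega>) \<partial>R)"
          using R B C by (subst emeasure_distr) (auto simp: is_path_measure_iff)
        also have "\<dots> = (\<integral>\<^sup>+z. emeasure (kernel D (snd (fst z), snd z)) C * indicator B z \<partial>distr R (MH n \<Otimes>\<^sub>M MU) ?hu)"
          by (subst nn_integral_distr) (auto simp: history_def)
        finally show ?thesis .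
      qed
      then show "emeasure (distr P ((MH n \<Otimes>\<^sub>M MU) \<Otimes>\<^sub>M MX) ?hux) (B \<times> C) =
          emeasure (distr Q ((MH n \<Otimes>\<^sub>M MU) \<Otimes>\<^sub>M MX) ?hux) (B \<times> C)"
        using P Q hu by simp
    qed (auto intro!: fin)
    then have "distr (distr P ((MH n \<Otimes>\<^sub>M MU) \<Otimes>\<^sub>M MX) ?hux) (MH (Suc n)) (extend_history n) =
        distr (distr Q ((MH n \<Otimes>\<^sub>M MU) \<Otimes>\<^sub>M MX) ?hux) (MH (Suc n)) (extend_history n)" by simp
    then show ?case
      by (simp add: distr_distr comp_def history_Suc[symmetric])
  qed
  then show ?thesis by (rule path_law_determined_by_histories[OF sP sQ pP])
qed

subsection \<open>Existence\<close>

text \<open>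
  The Ionescu-Tulcea theorem extends a sequence of Borel kernels, each of which appends one
  coordinate. The coordinates here are the pairs \<open>(x\<^sub>n, u\<^sub>n)\<close>: the kernel that appends such a pair draws
  \<open>x\<^sub>n\<close> from the initial law or the transition kernel and then \<open>u\<^sub>n\<close> from a Borel version \<open>g\<close> of the
  policy.
\<close>

definition entry :: "'x measure \<Rightarrow> nat \<Rightarrow> (nat \<Rightarrow> 'x \<times> 'u) \<Rightarrow> 'x measure" where
  "entry \<alpha> n p = (case n of 0 \<Rightarrow> \<alpha> | Suc m \<Rightarrow> kernel D (p m))"

lemma entry_measurable:
  assumes "\<alpha> \<in> space (prob_algebra MX)"
  shows "entry \<alpha> n \<in> MB n \<rightarrow>\<^sub>M prob_algebra MX"
proof (cases n)
  case 0
  then show ?thesis unfolding entry_def using assms by simp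
next
  case (Suc m)
  have "(\<lambda>p. kernel D (p m)) \<in> MB (Suc m) \<rightarrow>\<^sub>M prob_algebra MX"
    by (rule measurable_compose[OF _ kernel_measurable], rule measurable_component_singleton) simp
  then show ?thesis by (simp add: entry_def[abs_def] Suc)
qed

definition stage ::
  "'x measure \<Rightarrow> ((nat \<Rightarrow> 'x \<times> 'u) \<times> 'x \<Rightarrow> 'u measure) \<Rightarrow> nat \<Rightarrow> (nat \<Rightarrow> 'x \<times> 'u) \<Rightarrow> ('x \<times> 'u) measure"
  where "stage \<alpha> g n p = entry \<alpha> n p \<bind> (\<lambda>x. distr (g (p, x)) MP (Pair x))"

lemma stage_measurable:
  assumes [measurable]: "\<alpha> \<in> space (prob_algebra MX)" "g \<in> MH n \<rightarrow>\<^sub>M prob_algebra MU"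
  shows "stage \<alpha> g n \<in> MB n \<rightarrow>\<^sub>M prob_algebra MP"
proof -
  note [measurable] = entry_measurable[OF assms(1)]
  show ?thesis unfolding stage_def[abs_def] by measurable
qed

lemma nn_integral_stage:
  assumes \<alpha>: "\<alpha> \<in> space (prob_algebra MX)" and g: "g \<in> MH n \<rightarrow>\<^sub>M prob_algebra MU"
    and p: "p \<in> space (MB n)" and f [measurable]: "f \<in> borel_measurable MP"
  shows "(\<integral>\<^sup>+z. f z \<partial>stage \<alpha> g n p) = (\<integral>\<^sup>+x. \<integral>\<^sup>+u. f (x, u) \<partial>g (p, x) \<partial>entry \<alpha> n p)"
proof -
  have e: "entry \<alpha> n p \<in> space (prob_algebra MX)"
    using measurable_space[OF entry_measurable[OF \<alpha>] p] .
  then have se: "space (entry \<alpha> n p) = topspace (states D)"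
    by (auto simp: space_prob_algebra dest: sets_eq_imp_space_eq)
  have gp [measurable]: "(\<lambda>x. g (p, x)) \<in> MX \<rightarrow>\<^sub>M prob_algebra MU"
    using p by (intro measurable_compose[OF _ g]) auto
  have "(\<integral>\<^sup>+z. f z \<partial>stage \<alpha> g n p) =
      (\<integral>\<^sup>+x. \<integral>\<^sup>+z. f z \<partial>distr (g (p, x)) MP (Pair x) \<partial>entry \<alpha> n p)"
    unfolding stage_def by (rule nn_integral_bind_prob_algebra[OF e _ f]) measurable
  also have "\<dots> = (\<integral>\<^sup>+x. \<integral>\<^sup>+u. f (x, u) \<partial>g (p, x) \<partial>entry \<alpha> n p)"
  proof (rule nn_integral_cong)
    fix x assume "x \<in> space (entry \<alpha> n p)"
    then have x: "x \<in> space MX" by (simp add: se)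
    have [measurable_cong]: "sets (g (p, x)) = sets MU"
      using measurable_space[OF gp x] by (simp add: space_prob_algebra)
    show "(\<integral>\<^sup>+z. f z \<partial>distr (g (p, x)) MP (Pair x)) = (\<integral>\<^sup>+u. f (x, u) \<partial>g (p, x))"
      using x by (subst nn_integral_distr) auto
  qed
  finally show ?thesis .
qed

primrec prefix_law ::
  "'x measure \<Rightarrow> (nat \<Rightarrow> (nat \<Rightarrow> 'x \<times> 'u) \<times> 'x \<Rightarrow> 'u measure) \<Rightarrow> nat \<Rightarrow> (nat \<Rightarrow> 'x \<times> 'u) measure"
  where
    "prefix_law \<alpha> g 0 = return (MB 0) (\<lambda>_. undefined)"
  | "prefix_law \<alpha> g (Suc n) =
       prefix_law \<alpha> g n \<bind> (\<lambda>p. distr (stage \<alpha> (g n) n p) (MB (Suc n)) (fun_upd p n))"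

lemma prefix_law_cong:
  "(\<And>i. i < n \<Longrightarrow> g i = g' i) \<Longrightarrow> prefix_law \<alpha> g n = prefix_law \<alpha> g' n"
  by (induction n) auto

lemma append_measurable:
  "(\<lambda>(p, z). p(n := z)) \<in> MB n \<Otimes>\<^sub>M MP \<rightarrow>\<^sub>M MB (Suc n)"
  unfolding measurable_split_conv
  by (rule measurable_fun_upd[of _ "{..<n}"]) (auto simp: lessThan_Suc)

lemma prefix_step_measurable:
  assumes "\<alpha> \<in> space (prob_algebra MX)" "g \<in> MH n \<rightarrow>\<^sub>M prob_algebra MU"
  shows "(\<lambda>p. distr (stage \<alpha> g n p) (MB (Suc n)) (fun_upd p n)) \<in> MB n \<rightarrow>\<^sub>M prob_algebra (MB (Suc n))"
  by (rule measurable_distr_prob_space2[OF stage_measurable[OF assms] append_measurable])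

lemma prefix_law_in:
  assumes "\<alpha> \<in> space (prob_algebra MX)" "\<And>i. i < n \<Longrightarrow> g i \<in> MH i \<rightarrow>\<^sub>M prob_algebra MU"
  shows "prefix_law \<alpha> g n \<in> space (prob_algebra (MB n))"
  using assms(2)
proof (induction n)
  case 0
  then show ?case by (auto simp: space_prob_algebra space_PiM intro!: prob_space_return)
next
  case (Suc n)
  show ?case unfolding prefix_law.simps
    by (rule bind_in_space_prob_algebra[OF Suc.IH prefix_step_measurable[OF assms(1)]])
      (use Suc.prems in auto)
qed

lemma nn_integral_prefix_law_Suc:
  assumes \<alpha>: "\<alpha> \<in> space (prob_algebra MX)" and g: "\<And>i. i \<le> n \<Longrightarrow> g i \<in> MH i \<rightarrow>\<^sub>M prob_algebra MU"
    and f [measurable]: "f \<in> borel_measurable (MB (Suc n))"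
  shows "(\<integral>\<^sup>+p. f p \<partial>prefix_law \<alpha> g (Suc n)) =
    (\<integral>\<^sup>+p. \<integral>\<^sup>+x. \<integral>\<^sup>+u. f (p(n := (x, u))) \<partial>g n (p, x) \<partial>entry \<alpha> n p \<partial>prefix_law \<alpha> g n)"
proof -
  have pl: "prefix_law \<alpha> g n \<in> space (prob_algebra (MB n))" using prefix_law_in[OF \<alpha>] g by simp
  then have sp: "space (prefix_law \<alpha> g n) = space (MB n)"
    by (auto simp: space_prob_algebra dest: sets_eq_imp_space_eq)
  have gn: "g n \<in> MH n \<rightarrow>\<^sub>M prob_algebra MU" using g by simp
  have "(\<integral>\<^sup>+p. f p \<partial>prefix_law \<alpha> g (Suc n)) =
    (\<integral>\<^sup>+p. \<integral>\<^sup>+p'. f p' \<partial>distr (stage \<alpha> (g n) n p) (MB (Suc n)) (fun_upd p n) \<partial>prefix_law \<alpha> g n)"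
    unfolding prefix_law.simps
    by (rule nn_integral_bind_prob_algebra[OF pl prefix_step_measurable[OF \<alpha> gn] f])
  also have "\<dots> = (\<integral>\<^sup>+p. \<integral>\<^sup>+x. \<integral>\<^sup>+u. f (p(n := (x, u))) \<partial>g n (p, x) \<partial>entry \<alpha> n p \<partial>prefix_law \<alpha> g n)"
  proof (rule nn_integral_cong)
    fix p assume "p \<in> space (prefix_law \<alpha> g n)"
    then have p: "p \<in> space (MB n)" by (simp add: sp)
    have [measurable_cong]: "sets (stage \<alpha> (g n) n p) = sets MP"
      using measurable_space[OF stage_measurable[OF \<alpha> gn] p] by (simp add: space_prob_algebra)
    have [measurable]: "fun_upd p n \<in> MP \<rightarrow>\<^sub>M MB (Suc n)"
      using measurable_compose[OF measurable_Pair1'[OF p] append_measurable[of n]] by simp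
    show "(\<integral>\<^sup>+p'. f p' \<partial>distr (stage \<alpha> (g n) n p) (MB (Suc n)) (fun_upd p n)) =
        (\<integral>\<^sup>+x. \<integral>\<^sup>+u. f (p(n := (x, u))) \<partial>g n (p, x) \<partial>entry \<alpha> n p)"
      by (subst nn_integral_distr) (auto intro!: nn_integral_stage[OF \<alpha> gn p])
  qed
  finally show ?thesis .
qed

definition history_law ::
  "'x measure \<Rightarrow> (nat \<Rightarrow> (nat \<Rightarrow> 'x \<times> 'u) \<times> 'x \<Rightarrow> 'u measure) \<Rightarrow> nat \<Rightarrow> ((nat \<Rightarrow> 'x \<times> 'u) \<times> 'x) measure"
  where "history_law \<alpha> g n = prefix_law \<alpha> g n \<bind> (\<lambda>p. distr (entry \<alpha> n p) (MH n) (Pair p))"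

lemma history_step_measurable:
  assumes "\<alpha> \<in> space (prob_algebra MX)"
  shows "(\<lambda>p. distr (entry \<alpha> n p) (MH n) (Pair p)) \<in> MB n \<rightarrow>\<^sub>M prob_algebra (MH n)"
  by (rule measurable_distr_prob_space2[OF entry_measurable[OF assms]]) simp

lemma history_law_in:
  assumes "\<alpha> \<in> space (prob_algebra MX)" "\<And>i. i < n \<Longrightarrow> g i \<in> MH i \<rightarrow>\<^sub>M prob_algebra MU"
  shows "history_law \<alpha> g n \<in> space (prob_algebra (MH n))"
  unfolding history_law_def
  by (rule bind_in_space_prob_algebra[OF prefix_law_in[OF assms] history_step_measurable[OF assms(1)]])

lemma nn_integral_history_law:
  assumes \<alpha>: "\<alpha> \<in> space (prob_algebra MX)" and g: "\<And>i. i < n \<Longrightarrow> g i \<in> MH i \<rightarrow>\<^sub>M prob_algebra MU"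
    and f [measurable]: "f \<in> borel_measurable (MH n)"
  shows "(\<integral>\<^sup>+h. f h \<partial>history_law \<alpha> g n) = (\<integral>\<^sup>+p. \<integral>\<^sup>+x. f (p, x) \<partial>entry \<alpha> n p \<partial>prefix_law \<alpha> g n)"
proof -
  have pl: "prefix_law \<alpha> g n \<in> space (prob_algebra (MB n))" using prefix_law_in[OF \<alpha>] g by simp
  then have sp: "space (prefix_law \<alpha> g n) = space (MB n)"
    by (auto simp: space_prob_algebra dest: sets_eq_imp_space_eq)
  have "(\<integral>\<^sup>+h. f h \<partial>history_law \<alpha> g n) =
      (\<integral>\<^sup>+p. \<integral>\<^sup>+h. f h \<partial>distr (entry \<alpha> n p) (MH n) (Pair p) \<partial>prefix_law \<alpha> g n)"
    unfolding history_law_def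
    by (rule nn_integral_bind_prob_algebra[OF pl history_step_measurable[OF \<alpha>] f])
  also have "\<dots> = (\<integral>\<^sup>+p. \<integral>\<^sup>+x. f (p, x) \<partial>entry \<alpha> n p \<partial>prefix_law \<alpha> g n)"
  proof (rule nn_integral_cong)
    fix p assume "p \<in> space (prefix_law \<alpha> g n)"
    then have p: "p \<in> space (MB n)" by (simp add: sp)
    have [measurable_cong]: "sets (entry \<alpha> n p) = sets MX"
      using measurable_space[OF entry_measurable[OF \<alpha>] p] by (simp add: space_prob_algebra)
    show "(\<integral>\<^sup>+h. f h \<partial>distr (entry \<alpha> n p) (MH n) (Pair p)) = (\<integral>\<^sup>+x. f (p, x) \<partial>entry \<alpha> n p)"
      using p by (subst nn_integral_distr) auto
  qed
  finally show ?thesis .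
qed

text \<open>The version \<open>g n\<close> has to agree with \<open>\<pi> n\<close> almost surely under the law of the history at time \<open>n\<close>.
  This law is itself built from \<open>g 0, \<dots>, g (n - 1)\<close> only, so the versions can be chosen one after the
  other.\<close>

lemma borel_versions_of_policy:
  assumes \<alpha>: "\<alpha> \<in> space (prob_algebra MX)"
    and \<pi>: "\<And>n. \<pi> n \<in> universal_completion (MH n) \<rightarrow>\<^sub>M prob_algebra MU"
  shows "\<exists>g. (\<forall>n. g n \<in> MH n \<rightarrow>\<^sub>M prob_algebra MU) \<and> (\<forall>n. AE h in history_law \<alpha> g n. \<pi> n h = g n h)"
proof -
  obtain G where G: "countable G" "Int_stable G" "G \<subseteq> Pow (space MU)" "sets MU = sigma_sets (space MU) G"
    using countable_generator_borel_of[OF second_countable_inputs] by (metis space_borel_of)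
  define Q where "Q = (\<lambda>g n r. r \<in> MH n \<rightarrow>\<^sub>M prob_algebra MU \<and> (AE h in history_law \<alpha> g n. \<pi> n h = r h))"
  have "\<exists>g. \<forall>n. Q g n (g n)"
  proof (rule dependent_wellorder_choice)
    fix r and f g :: "nat \<Rightarrow> (nat \<Rightarrow> 'x \<times> 'u) \<times> 'x \<Rightarrow> 'u measure" and n
    assume "\<And>i. i < n \<Longrightarrow> f i = g i"
    then have eq: "prefix_law \<alpha> f n = prefix_law \<alpha> g n" by (rule prefix_law_cong)
    show "Q f n r = Q g n r" unfolding Q_def history_law_def eq by (rule refl)
  next
    fix n and f :: "nat \<Rightarrow> (nat \<Rightarrow> 'x \<times> 'u) \<times> 'x \<Rightarrow> 'u measure"
    assume "\<And>i. i < n \<Longrightarrow> Q f i (f i)"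
    then have hl: "history_law \<alpha> f n \<in> space (prob_algebra (MH n))"
      by (intro history_law_in[OF \<alpha>]) (simp add: Q_def)
    from measurable_universal_completionD[OF \<pi> this]
    obtain r where "r \<in> history_law \<alpha> f n \<rightarrow>\<^sub>M prob_algebra MU" "AE h in history_law \<alpha> f n. \<pi> n h = r h"
      by (rule kernel_AE_eq_borel_kernel[OF _ G]) (use inputs_nonempty in simp_all)
    moreover have "sets (history_law \<alpha> f n) = sets (MH n)" using hl by (simp add: space_prob_algebra)
    ultimately show "\<exists>r. Q f n r"
      unfolding Q_def by (intro exI[of _ r]) (simp cong: measurable_cong_sets)
  qed
  then obtain g where "\<forall>n. Q g n (g n)" by (elim exE)
  then show ?thesis unfolding Q_def by (intro exI[of _ g]) simp
qed

text \<open>The Ionescu-Tulcea theorem with its finite-dimensional laws in the form \<open>prefix_law\<close>, from whose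
  one-step integrals (\<open>nn_integral_prefix_law_Suc\<close>) the conditional laws are read off.\<close>

lemma ionescu_tulcea_path_law:
  assumes \<alpha>: "\<alpha> \<in> space (prob_algebra MX)" and g: "\<And>i. g i \<in> MH i \<rightarrow>\<^sub>M prob_algebra MU"
  shows "\<exists>P. prob_space P \<and> sets P = sets MW \<and>
    (\<forall>n. distr P (MB n) (\<lambda>\<omega>. restrict \<omega> {..<n}) = prefix_law \<alpha> g n)"
proof -
  have st: "stage \<alpha> (g n) n \<in> MB n \<rightarrow>\<^sub>M prob_algebra MP" for n by (rule stage_measurable[OF \<alpha> g])
  interpret IT: Ionescu_Tulcea "\<lambda>n. stage \<alpha> (g n) n" "\<lambda>_. MP"
  proof (rule Ionescu_Tulcea.intro)
    show "stage \<alpha> (g i) i \<in> PiM {0..<i} (\<lambda>_. MP) \<rightarrow>\<^sub>M subprob_algebra MP" for i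
      using measurable_prob_algebraD[OF st[of i]] by (simp add: atLeast0LessThan)
    fix i :: nat and x assume "x \<in> space (PiM {0..<i} (\<lambda>_. MP))"
    then show "prob_space (stage \<alpha> (g i) i x)"
      using measurable_space[OF st, of x i] by (simp add: atLeast0LessThan space_prob_algebra)
  qed
  have C: "IT.C 0 n (\<lambda>_. undefined) = prefix_law \<alpha> g n" for n
    by (induction n) (simp_all add: IT.eP_def[abs_def] atLeast0LessThan)
  \<comment> \<open>The theorem describes the marginal on a finite index set by the shortest
    initial segment that covers it.\<close>
  have up: "IT.up_to {..<n} = n" for n
  proof (rule antisym)
    show "IT.up_to {..<n} \<le> n" by (subst IT.up_to_iff) auto
    show "n \<le> IT.up_to {..<n}" using IT.up_to_less[of "{..<n}" "n - 1"] by (cases n) auto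
  qed
  have und: "(\<lambda>_. undefined) \<in> space (PiM {0..<0::nat} (\<lambda>_. MP))" by (simp add: space_PiM)
  have marginal: "distr IT.PF.lim (MB n) (\<lambda>\<omega>. restrict \<omega> {..<n}) = prefix_law \<alpha> g n" for n
    using IT.distr_C[OF order_refl und, of n]
    by (simp add: IT.distr_lim IT.CI_def up C atLeast0LessThan)
  have "prob_space (distr IT.PF.lim (MB 0) (\<lambda>\<omega>. restrict \<omega> {..<0}))"
    unfolding marginal using prefix_law_in[where g = g and n = 0, OF \<alpha>] g by (simp add: space_prob_algebra)
  moreover have "(\<lambda>\<omega>. restrict \<omega> {..<0}) \<in> IT.PF.lim \<rightarrow>\<^sub>M MB 0"
    unfolding measurable_cong_sets[OF IT.PF.sets_lim refl] by (rule measurable_restrict_subset) simp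
  ultimately have "prob_space IT.PF.lim"
    using prob_space_distrD by blast
  then show ?thesis
    using marginal by (intro exI[of _ IT.PF.lim] conjI allI) simp_all
qed

text \<open>The path law of the Borel versions is also a path law of the policy: in the second condition
  the policy is evaluated at the history at time \<open>n\<close>, whose law is the one for which the version
  was chosen.\<close>

lemma path_law_exists:
  assumes \<alpha>: "\<alpha> \<in> space (prob_algebra MX)"
    and \<pi>: "\<And>n. \<pi> n \<in> universal_completion (MH n) \<rightarrow>\<^sub>M prob_algebra MU"
  obtains P where "is_path_measure D \<alpha> \<pi> P"
proof -
  obtain g where "(\<forall>n. g n \<in> MH n \<rightarrow>\<^sub>M prob_algebra MU) \<and> (\<forall>n. AE h in history_law \<alpha> g n. \<pi> n h = g n h)"
    using borel_versions_of_policy[where \<pi> = \<pi>, OF \<alpha> \<pi>] by (elim exE)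
  then have g [measurable]: "\<And>n. g n \<in> MH n \<rightarrow>\<^sub>M prob_algebra MU"
    and ae: "\<And>n. AE h in history_law \<alpha> g n. \<pi> n h = g n h"
    by simp_all
  obtain P where "prob_space P \<and> sets P = sets MW \<and>
      (\<forall>n. distr P (MB n) (\<lambda>\<omega>. restrict \<omega> {..<n}) = prefix_law \<alpha> g n)"
    using ionescu_tulcea_path_law[OF \<alpha> g] by (elim exE)
  then have pP: "prob_space P" and sP [measurable_cong]: "sets P = sets MW"
    and dP: "\<And>n. distr P (MB n) (\<lambda>\<omega>. restrict \<omega> {..<n}) = prefix_law \<alpha> g n"
    by simp_all
  interpret prob_space P by (rule pP)
  have spP: "space P = space MW" using sP by (rule sets_eq_imp_space_eq)
  have pl: "prefix_law \<alpha> g n \<in> space (prob_algebra (MB n))" for n by (rule prefix_law_in[OF \<alpha> g])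
  have sp: "space (prefix_law \<alpha> g n) = space (MB n)" for n
    using pl[of n] by (auto simp: space_prob_algebra dest: sets_eq_imp_space_eq)
  have entry: "prob_space (entry \<alpha> n p)" "sets (entry \<alpha> n p) = sets MX" if "p \<in> space (MB n)" for n p
    using measurable_space[OF entry_measurable[OF \<alpha>] that] by (auto simp: space_prob_algebra)
  have gp: "prob_space (g n (p, x))" "sets (g n (p, x)) = sets MU"
    if "p \<in> space (MB n)" "x \<in> space (entry \<alpha> n p)" for n p x
    using measurable_space[OF g, of "(p, x)" n] that sets_eq_imp_space_eq[OF entry(2)[OF that(1)]]
    by (auto simp: space_prob_algebra space_pair_measure)
  have [measurable]: "kernel D \<in> MP \<rightarrow>\<^sub>M subprob_algebra MX" "\<And>n. g n \<in> MH n \<rightarrow>\<^sub>M subprob_algebra MU"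
    by (rule measurable_prob_algebraD, measurable)+
  have int_P: "(\<integral>\<^sup>+\<omega>. f (restrict \<omega> {..<n}) \<partial>P) = (\<integral>\<^sup>+p. f p \<partial>prefix_law \<alpha> g n)"
    if "f \<in> borel_measurable (MB n)" for f n
    unfolding dP[symmetric] using that by (subst nn_integral_distr) auto
  \<comment> \<open>Disintegration of the joint law of the history and the input at time \<open>n\<close>.\<close>
  have step: "(\<integral>\<^sup>+\<omega>. f (history n \<omega>) (snd (\<omega> n)) \<partial>P) =
      (\<integral>\<^sup>+p. \<integral>\<^sup>+x. \<integral>\<^sup>+u. f (p, x) u \<partial>g n (p, x) \<partial>entry \<alpha> n p \<partial>prefix_law \<alpha> g n)"
    if f [measurable]: "case_prod f \<in> borel_measurable (MH n \<Otimes>\<^sub>M MU)" for f n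
  proof -
    let ?f = "\<lambda>p. f (restrict p {..<n}, fst (p n)) (snd (p n))"
    have [measurable]: "(\<lambda>p. restrict p {..<n}) \<in> MB (Suc n) \<rightarrow>\<^sub>M MB n"
      by (rule measurable_restrict_subset) auto
    have [measurable]: "(\<lambda>p. p n) \<in> MB (Suc n) \<rightarrow>\<^sub>M MP" by (rule measurable_component_singleton) simp
    have m: "?f \<in> borel_measurable (MB (Suc n))" by measurable
    have "(\<integral>\<^sup>+\<omega>. f (history n \<omega>) (snd (\<omega> n)) \<partial>P) = (\<integral>\<^sup>+\<omega>. ?f (restrict \<omega> {..<Suc n}) \<partial>P)"
      by (simp add: history_def Int_absorb1 subset_iff)
    also have "\<dots> = (\<integral>\<^sup>+p. ?f p \<partial>prefix_law \<alpha> g (Suc n))" by (rule int_P[OF m])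
    also have "\<dots> = (\<integral>\<^sup>+p. \<integral>\<^sup>+x. \<integral>\<^sup>+u. ?f (p(n := (x, u))) \<partial>g n (p, x) \<partial>entry \<alpha> n p \<partial>prefix_law \<alpha> g n)"
      by (rule nn_integral_prefix_law_Suc[OF \<alpha> g m])
    also have "\<dots> = (\<integral>\<^sup>+p. \<integral>\<^sup>+x. \<integral>\<^sup>+u. f (p, x) u \<partial>g n (p, x) \<partial>entry \<alpha> n p \<partial>prefix_law \<alpha> g n)"
    proof (intro nn_integral_cong)
      fix p x u assume "p \<in> space (prefix_law \<alpha> g n)"
      then have "restrict (p(n := (x, u))) {..<n} = p"
        by (auto simp: sp space_PiM PiE_iff extensional_def fun_eq_iff)
      then show "?f (p(n := (x, u))) = f (p, x) u" by simp
    qed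
    finally show ?thesis .
  qed
  have step_x: "(\<integral>\<^sup>+\<omega>. f (history n \<omega>) \<partial>P) = (\<integral>\<^sup>+p. \<integral>\<^sup>+x. f (p, x) \<partial>entry \<alpha> n p \<partial>prefix_law \<alpha> g n)"
    if f [measurable]: "f \<in> borel_measurable (MH n)" for f n
  proof -
    have "(\<integral>\<^sup>+\<omega>. f (history n \<omega>) \<partial>P) =
        (\<integral>\<^sup>+p. \<integral>\<^sup>+x. \<integral>\<^sup>+u. f (p, x) \<partial>g n (p, x) \<partial>entry \<alpha> n p \<partial>prefix_law \<alpha> g n)"
      by (rule step) measurable
    also have "\<dots> = (\<integral>\<^sup>+p. \<integral>\<^sup>+x. f (p, x) \<partial>entry \<alpha> n p \<partial>prefix_law \<alpha> g n)"
      using gp by (intro nn_integral_cong) (simp add: sp prob_space.emeasure_space_1)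
    finally show ?thesis .
  qed
  have hist: "distr P (MH n) (history n) = history_law \<alpha> g n" for n
  proof (rule measure_eqI)
    show s: "sets (distr P (MH n) (history n)) = sets (history_law \<alpha> g n)"
      using history_law_in[OF \<alpha> g, of n] by (simp add: space_prob_algebra)
    fix A assume "A \<in> sets (distr P (MH n) (history n))"
    then have A [measurable]: "A \<in> sets (MH n)" by simp
    have "emeasure (distr P (MH n) (history n)) A = (\<integral>\<^sup>+\<omega>. indicator A (history n \<omega>) \<partial>P)"
      by (subst nn_integral_indicator[symmetric], simp, subst nn_integral_distr) auto
    also have "\<dots> = (\<integral>\<^sup>+h. indicator A h \<partial>history_law \<alpha> g n)"
      unfolding nn_integral_history_law[OF \<alpha> g borel_measurable_indicator[OF A]] by (rule step_x) simp
    also have "\<dots> = emeasure (history_law \<alpha> g n) A"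
      by (rule nn_integral_indicator) (simp add: s[symmetric])
    finally show "emeasure (distr P (MH n) (history n)) A = emeasure (history_law \<alpha> g n) A" .
  qed
  have "is_path_measure D \<alpha> \<pi> P"
    unfolding is_path_measure_iff
  proof (intro conjI allI ballI)
    fix C assume C [measurable]: "C \<in> sets MX"
    have "emeasure P {\<omega> \<in> space MW. fst (\<omega> 0) \<in> C} = (\<integral>\<^sup>+\<omega>. indicator C (snd (history 0 \<omega>)) \<partial>P)"
      by (subst nn_integral_indicator[symmetric])
        (auto simp: history_def spP[symmetric] simp del: nn_integral_indicator
          intro!: nn_integral_cong split: split_indicator)
    also have "\<dots> = (\<integral>\<^sup>+p. \<integral>\<^sup>+x. indicator C x \<partial>entry \<alpha> 0 p \<partial>prefix_law \<alpha> g 0)"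
      by (subst step_x) auto
    also have "\<dots> = emeasure \<alpha> C"
    proof -
      have "prob_space (prefix_law \<alpha> g 0)" "sets \<alpha> = sets MX"
        using pl[of 0] \<alpha> by (auto simp: space_prob_algebra)
      then show ?thesis
        using C by (simp add: entry_def prob_space.emeasure_space_1 del: prefix_law.simps)
    qed
    finally show "emeasure P {\<omega> \<in> space MW. fst (\<omega> 0) \<in> C} = emeasure \<alpha> C" .
  next
    fix n B C assume B [measurable]: "B \<in> sets (MH n)" and C [measurable]: "C \<in> sets MU"
    have "emeasure P {\<omega> \<in> space MW. history n \<omega> \<in> B \<and> snd (\<omega> n) \<in> C} =
        (\<integral>\<^sup>+\<omega>. indicator B (history n \<omega>) * indicator C (snd (\<omega> n)) \<partial>P)"
      by (subst nn_integral_indicator[symmetric])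
        (auto simp: spP[symmetric] simp del: nn_integral_indicator
          intro!: nn_integral_cong split: split_indicator)
    also have "\<dots> = (\<integral>\<^sup>+p. \<integral>\<^sup>+x. \<integral>\<^sup>+u. indicator B (p, x) * indicator C u \<partial>g n (p, x) \<partial>entry \<alpha> n p \<partial>prefix_law \<alpha> g n)"
      by (rule step) measurable
    also have "\<dots> = (\<integral>\<^sup>+p. \<integral>\<^sup>+x. emeasure (g n (p, x)) C * indicator B (p, x) \<partial>entry \<alpha> n p \<partial>prefix_law \<alpha> g n)"
    proof (intro nn_integral_cong)
      fix p x assume "p \<in> space (prefix_law \<alpha> g n)" "x \<in> space (entry \<alpha> n p)"
      then have "C \<in> sets (g n (p, x))" using gp C by (simp add: sp)
      then show "(\<integral>\<^sup>+u. indicator B (p, x) * indicator C u \<partial>g n (p, x)) =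
          emeasure (g n (p, x)) C * indicator B (p, x)"
        by (simp add: nn_integral_cmult mult.commute[of "emeasure _ _"])
    qed
    also have "\<dots> = (\<integral>\<^sup>+\<omega>. emeasure (g n (history n \<omega>)) C * indicator B (history n \<omega>) \<partial>P)"
      by (rule step_x[symmetric]) measurable
    also have "\<dots> = (\<integral>\<^sup>+\<omega>. emeasure (\<pi> n (history n \<omega>)) C * indicator B (history n \<omega>) \<partial>P)"
    proof (rule nn_integral_cong_AE)
      have "AE h in distr P (MH n) (history n). \<pi> n h = g n h" unfolding hist by (rule ae)
      then have "AE \<omega> in P. \<pi> n (history n \<omega>) = g n (history n \<omega>)" by (rule AE_distrD[rotated]) simp
      then show "AE \<omega> in P. emeasure (g n (history n \<omega>)) C * indicator B (history n \<omega>) =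
          emeasure (\<pi> n (history n \<omega>)) C * indicator B (history n \<omega>)" by eventually_elim simp
    qed
    finally show "emeasure P {\<omega> \<in> space MW. history n \<omega> \<in> B \<and> snd (\<omega> n) \<in> C} =
        (\<integral>\<^sup>+\<omega>. emeasure (\<pi> n (history n \<omega>)) C * indicator B (history n \<omega>) \<partial>completion P)"
      by (simp add: nn_integral_completion)
  next
    fix n B C assume B [measurable]: "B \<in> sets (MH n \<Otimes>\<^sub>M MU)" and C [measurable]: "C \<in> sets MX"
    have event: "{\<omega> \<in> space P. (history n \<omega>, snd (\<omega> n)) \<in> B \<and> fst (\<omega> (Suc n)) \<in> C} \<in> sets P"
      by measurable
    let ?b = "\<lambda>p. ((restrict p {..<n}, fst (p n)), snd (p n))"
    have [measurable]: "(\<lambda>p. restrict p {..<n}) \<in> MB (Suc n) \<rightarrow>\<^sub>M MB n"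
      by (rule measurable_restrict_subset) auto
    have [measurable]: "(\<lambda>p. p n) \<in> MB (Suc n) \<rightarrow>\<^sub>M MP" by (rule measurable_component_singleton) simp
    have b: "?b (restrict \<omega> {..<Suc n}) = (history n \<omega>, snd (\<omega> n))" for \<omega> :: "nat \<Rightarrow> 'x \<times> 'u"
      by (simp add: history_def Int_absorb1 subset_iff)
    have "emeasure P {\<omega> \<in> space MW. (history n \<omega>, snd (\<omega> n)) \<in> B \<and> fst (\<omega> (Suc n)) \<in> C} =
        (\<integral>\<^sup>+\<omega>. indicator B (?b (fst (history (Suc n) \<omega>))) * indicator C (snd (history (Suc n) \<omega>)) \<partial>P)"
      unfolding history_def[of "Suc n"] fst_conv snd_conv b
      by (subst nn_integral_indicator[symmetric])
        (auto simp: event spP[symmetric] simp del: nn_integral_indicator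
          intro!: nn_integral_cong split: split_indicator)
    also have "\<dots> = (\<integral>\<^sup>+p. \<integral>\<^sup>+x. indicator B (?b p) * indicator C x \<partial>entry \<alpha> (Suc n) p \<partial>prefix_law \<alpha> g (Suc n))"
      by (subst step_x) auto
    also have "\<dots> = (\<integral>\<^sup>+p. emeasure (kernel D (p n)) C * indicator B (?b p) \<partial>prefix_law \<alpha> g (Suc n))"
    proof (intro nn_integral_cong)
      fix p assume "p \<in> space (prefix_law \<alpha> g (Suc n))"
      then have "C \<in> sets (entry \<alpha> (Suc n) p)" using entry[of p "Suc n"] C by (simp add: sp del: prefix_law.simps)
      then show "(\<integral>\<^sup>+x. indicator B (?b p) * indicator C x \<partial>entry \<alpha> (Suc n) p) =
          emeasure (kernel D (p n)) C * indicator B (?b p)"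
        by (simp add: nn_integral_cmult mult.commute[of "emeasure _ _"] entry_def)
    qed
    also have "\<dots> = (\<integral>\<^sup>+\<omega>. emeasure (kernel D (restrict \<omega> {..<Suc n} n)) C * indicator B (?b (restrict \<omega> {..<Suc n})) \<partial>P)"
      by (rule int_P[symmetric]) measurable
    finally show "emeasure P {\<omega> \<in> space MW. (history n \<omega>, snd (\<omega> n)) \<in> B \<and> fst (\<omega> (Suc n)) \<in> C} =
        (\<integral>\<^sup>+\<omega>. emeasure (kernel D (\<omega> n)) C * indicator B (history n \<omega>, snd (\<omega> n)) \<partial>P)"
      unfolding b by simp
  qed (fact sP pP)+
  then show ?thesis by (rule that)
qed

lemma path_measure_eqI:
  assumes "\<pi> \<in> policies D" "is_path_measure D \<alpha> \<pi> P"
  shows "path_measure D \<alpha> \<pi> = P"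
  unfolding path_measure_def
  by (rule the_equality)
     (auto intro: assms(2) path_law_unique[OF policy_measurable[OF assms(1)] _ assms(2)])

lemma is_path_measure_path_measure:
  assumes "\<pi> \<in> policies D" "\<alpha> \<in> space (prob_algebra MX)"
  shows "is_path_measure D \<alpha> \<pi> (path_measure D \<alpha> \<pi>)"
  using path_law_exists[OF assms(2) policy_measurable[OF assms(1)]] path_measure_eqI[OF assms(1)] by metis

end

section \<open>The composition with an automaton\<close>

lemma measurable_borel_of_discrete:
  "M \<rightarrow>\<^sub>M borel_of (discrete_topology A) = M \<rightarrow>\<^sub>M count_space A"
  by (rule measurable_cong_sets) (simp_all add: sets_borel_of_discrete)

lemma run_cong: "(\<And>j. j < k \<Longrightarrow> w j = w' j) \<Longrightarrow> run T w k = run T w' k"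
  by (induction k) auto

context countable_mp
begin

lemma policies_iff:
  "\<pi> \<in> policies D \<longleftrightarrow>
     (\<forall>n. \<pi> n \<in> universal_completion (MH n) \<rightarrow>\<^sub>M prob_algebra MU \<and>
          (\<forall>h\<in>space (MH n). emeasure (completion (\<pi> n h)) (section_at D (snd h)) = 1))"
proof -
  have "universal_completion (borel_of (history_space D n)) = universal_completion (MH n)" for n
    by (rule universal_completion_cong[OF sets_borel_history_space])
  then show ?thesis unfolding policies_def by (simp only: topspace_history_space mem_Collect_eq)
qed

text \<open>A policy lifted to the composition and pulled back again is restored only on proper histories,
  which are extensional functions.\<close>

lemma path_measure_cong:
  assumes "\<And>n h. h \<in> space (MH n) \<Longrightarrow> \<pi> n h = \<pi>' n h"
  shows "path_measure D \<alpha> \<pi> = path_measure D \<alpha> \<pi>'"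
proof -
  have "(\<integral>\<^sup>+\<omega>. emeasure (\<pi> n (history n \<omega>)) C * indicator B (history n \<omega>) \<partial>completion P) =
      (\<integral>\<^sup>+\<omega>. emeasure (\<pi>' n (history n \<omega>)) C * indicator B (history n \<omega>) \<partial>completion P)"
    if "sets P = sets MW" for P B C n
  proof (rule nn_integral_cong)
    fix \<omega> assume "\<omega> \<in> space (completion P)"
    then have "\<omega> \<in> space MW" using sets_eq_imp_space_eq[OF that] by simp
    then have "history n \<omega> \<in> space (MH n)" by (rule measurable_space[OF history_measurable])
    then show "emeasure (\<pi> n (history n \<omega>)) C * indicator B (history n \<omega>) =
        emeasure (\<pi>' n (history n \<omega>)) C * indicator B (history n \<omega>)" using assms by simp
  qed
  then have "is_path_measure D \<alpha> \<pi> = is_path_measure D \<alpha> \<pi>'"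
    unfolding fun_eq_iff is_path_measure_iff by (auto cong: conj_cong)
  then show ?thesis unfolding path_measure_def by simp
qed

end

locale composed_mp = countable_mp D for D :: "('x, 'u) mp" +
  fixes L :: "'x \<Rightarrow> 's" and T :: "('q, 's) dts"
  assumes deterministic: "deterministic_ts T"
    and label_measurable: "L \<in> borel_of (states D) \<rightarrow>\<^sub>M borel_of (discrete_topology (alphabet T))"
begin

abbreviation MQ :: "'q measure" where "MQ \<equiv> borel_of (discrete_topology (nodes T))"

lemma states_composition:
  "states (composition D L T) = prod_topology (states D) (discrete_topology (nodes T))"
  and inputs_composition [simp]: "inputs (composition D L T) = inputs D"
  by (simp_all add: composition_def)

lemma second_countable_nodes: "second_countable (discrete_topology (nodes T))"
  using deterministic
  by (simp add: deterministic_ts_def second_countable_discrete_topology countable_finite)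

lemma sets_composed_states [measurable_cong]: "sets (borel_of (states (composition D L T))) = sets (MX \<Otimes>\<^sub>M MQ)"
  unfolding states_composition
  by (rule sets_borel_of_prod_topology[OF second_countable_states second_countable_nodes])

lemma label_in_alphabet: "x \<in> space MX \<Longrightarrow> L x \<in> alphabet T"
  using measurable_space[OF label_measurable] by simp

text \<open>Both \<open>q\<close> and \<open>L x\<close> take values in finite sets, on whose product every function is measurable.\<close>

lemma next_node_measurable: "(\<lambda>z. trans T (snd z) (L (fst z))) \<in> MX \<Otimes>\<^sub>M MQ \<rightarrow>\<^sub>M MQ"
proof -
  have [measurable]: "L \<in> MX \<rightarrow>\<^sub>M count_space (alphabet T)"
    using label_measurable by (simp only: measurable_borel_of_discrete)
  have [measurable]: "snd \<in> MX \<Otimes>\<^sub>M MQ \<rightarrow>\<^sub>M count_space (nodes T)"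
    using measurable_snd[of MX MQ] by (simp only: measurable_borel_of_discrete)
  have fin: "countable (nodes T)" "countable (alphabet T)"
    using deterministic by (auto simp: deterministic_ts_def countable_finite)
  have "(\<lambda>z. (snd z, L (fst z))) \<in> MX \<Otimes>\<^sub>M MQ \<rightarrow>\<^sub>M count_space (nodes T) \<Otimes>\<^sub>M count_space (alphabet T)"
    by measurable
  then have "(\<lambda>z. (snd z, L (fst z))) \<in> MX \<Otimes>\<^sub>M MQ \<rightarrow>\<^sub>M count_space (nodes T \<times> alphabet T)"
    by (simp add: pair_measure_countable[OF fin])
  moreover have "(\<lambda>(q, a). trans T q a) \<in> count_space (nodes T \<times> alphabet T) \<rightarrow>\<^sub>M MQ"
    using deterministic by (auto simp: deterministic_ts_def)
  ultimately have "(\<lambda>z. (\<lambda>(q, a). trans T q a) (snd z, L (fst z))) \<in> MX \<Otimes>\<^sub>M MQ \<rightarrow>\<^sub>M MQ"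
    by (rule measurable_compose)
  then show ?thesis by simp
qed

lemma composed_kernel_measurable:
  "kernel (composition D L T) \<in> (MX \<Otimes>\<^sub>M MQ) \<Otimes>\<^sub>M MU \<rightarrow>\<^sub>M prob_algebra (MX \<Otimes>\<^sub>M MQ)"
proof -
  note [measurable] = measurable_compose[OF measurable_fst next_node_measurable]
  have "(\<lambda>z. kernel D (fst (fst z), snd z) \<Otimes>\<^sub>M return MQ (trans T (snd (fst z)) (L (fst (fst z)))))
      \<in> (MX \<Otimes>\<^sub>M MQ) \<Otimes>\<^sub>M MU \<rightarrow>\<^sub>M prob_algebra (MX \<Otimes>\<^sub>M MQ)"
    by (intro measurable_pair_prob measurable_compose[OF _ measurable_return_prob_space]) measurable
  moreover have "kernel (composition D L T) =
      (\<lambda>z. kernel D (fst (fst z), snd z) \<Otimes>\<^sub>M return MQ (trans T (snd (fst z)) (L (fst (fst z)))))"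
    by (auto simp: composition_def fun_eq_iff)
  ultimately show ?thesis by simp
qed

sublocale comp: countable_mp "composition D L T"
proof
  show "second_countable (states (composition D L T))"
    unfolding states_composition by (rule second_countable_prod_topology[OF second_countable_states second_countable_nodes])
  show "second_countable (inputs (composition D L T))" "topspace (inputs (composition D L T)) \<noteq> {}"
    using second_countable_inputs inputs_nonempty by simp_all
  have "sets (borel_of (prod_topology (states (composition D L T)) (inputs (composition D L T)))) =
      sets (borel_of (states (composition D L T)) \<Otimes>\<^sub>M MU)"
    using sets_borel_of_prod_topology[of "states (composition D L T)" "inputs D"] second_countable_inputs
      second_countable_prod_topology[OF second_countable_states second_countable_nodes]
    by (simp add: states_composition)
  also have "\<dots> = sets ((MX \<Otimes>\<^sub>M MQ) \<Otimes>\<^sub>M MU)"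
    by (rule sets_pair_measure_cong[OF sets_composed_states refl])
  finally have eq: "sets (borel_of (prod_topology (states (composition D L T)) (inputs (composition D L T)))) =
    sets ((MX \<Otimes>\<^sub>M MQ) \<Otimes>\<^sub>M MU)" .
  have alg: "prob_algebra (borel_of (states (composition D L T))) = prob_algebra (MX \<Otimes>\<^sub>M MQ)"
    by (simp add: prob_algebra_def subprob_algebra_cong[OF sets_composed_states])
  show "kernel (composition D L T) \<in>
      borel_of (prod_topology (states (composition D L T)) (inputs (composition D L T))) \<rightarrow>\<^sub>M
      prob_algebra (borel_of (states (composition D L T)))"
    unfolding measurable_cong_sets[OF eq refl] alg by (rule composed_kernel_measurable)
qed

lemma run_measurable:
  assumes "{..<k} \<subseteq> I"
  shows "(\<lambda>p. run T (trace L p) k) \<in> PiM I (\<lambda>_. MP) \<rightarrow>\<^sub>M MQ"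
  using assms
proof (induction k)
  case 0
  then show ?case using deterministic by (simp add: deterministic_ts_def)
next
  case (Suc k)
  then have k: "{..<k} \<subseteq> I" "k \<in> I" by (auto simp: lessThan_Suc)
  note [measurable] = Suc.IH[OF k(1)]
  have [measurable]: "(\<lambda>p. p k) \<in> PiM I (\<lambda>_. MP) \<rightarrow>\<^sub>M MP" using k(2) by (rule measurable_component_singleton)
  have "(\<lambda>p. (fst (p k), run T (trace L p) k)) \<in> PiM I (\<lambda>_. MP) \<rightarrow>\<^sub>M MX \<Otimes>\<^sub>M MQ" by measurable
  from measurable_compose[OF this next_node_measurable] show ?case by (simp add: trace_def)
qed

text \<open>
  The state of the automaton at time \<open>n\<close> is a function of \<open>x\<^sub>0, \<dots>, x\<^bsub>n-1\<^esub>\<close>. Hence a path of the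
  process determines the path of the composition above it, and likewise a history: attaching the
  run commutes with taking the history.
\<close>

definition attach_run :: "(nat \<Rightarrow> 'x \<times> 'u) \<Rightarrow> nat \<Rightarrow> ('x \<times> 'q) \<times> 'u" where
  "attach_run \<omega> n = ((fst (\<omega> n), run T (trace L \<omega>) n), snd (\<omega> n))"

definition attach_run_history ::
  "nat \<Rightarrow> (nat \<Rightarrow> 'x \<times> 'u) \<times> 'x \<Rightarrow> (nat \<Rightarrow> ('x \<times> 'q) \<times> 'u) \<times> 'x \<times> 'q" where
  "attach_run_history n h =
     (restrict (attach_run (fst h)) {..<n}, (snd h, run T (trace L (fst h)) n))"

definition drop_run_history ::
  "nat \<Rightarrow> (nat \<Rightarrow> ('x \<times> 'q) \<times> 'u) \<times> 'x \<times> 'q \<Rightarrow> (nat \<Rightarrow> 'x \<times> 'u) \<times> 'x" where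
  "drop_run_history n h =
     (restrict (\<lambda>k. (fst (fst (fst h k)), snd (fst h k))) {..<n}, fst (snd h))"

lemma run_trace_restrict: "k \<le> n \<Longrightarrow> run T (trace L (restrict \<omega> {..<n})) k = run T (trace L \<omega>) k"
  by (rule run_cong) (simp add: trace_def)

lemma history_attach_run: "history n (attach_run \<omega>) = attach_run_history n (history n \<omega>)"
  by (auto simp: history_def attach_run_history_def attach_run_def run_trace_restrict fun_eq_iff)

lemma attach_run_measurable [measurable]: "attach_run \<in> MW \<rightarrow>\<^sub>M comp.MW"
proof -
  note [measurable] = run_measurable
  have "(\<lambda>\<omega>. restrict (attach_run \<omega>) UNIV) \<in> MW \<rightarrow>\<^sub>M comp.MW"
    unfolding attach_run_def by (rule measurable_restrict) auto
  then show ?thesis by (simp add: restrict_def)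
qed

lemma attach_run_history_measurable [measurable]: "attach_run_history n \<in> MH n \<rightarrow>\<^sub>M comp.MH n"
proof -
  have [measurable]: "(\<lambda>h. run T (trace L (fst h)) k) \<in> MH n \<rightarrow>\<^sub>M MQ" if "k \<le> n" for k
    using that by (intro measurable_compose[OF measurable_fst run_measurable]) auto
  have [measurable]: "(\<lambda>h. fst h k) \<in> MH n \<rightarrow>\<^sub>M MP" if "k < n" for k
    using that by (intro measurable_compose[OF measurable_fst measurable_component_singleton]) auto
  have "(\<lambda>h. restrict (attach_run (fst h)) {..<n}) \<in> MH n \<rightarrow>\<^sub>M comp.MB n"
    unfolding attach_run_def by (rule measurable_restrict) auto
  then show ?thesis
    unfolding attach_run_history_def[abs_def] by measurable
qed

lemma drop_run_history_measurable: "drop_run_history n \<in> comp.MH n \<rightarrow>\<^sub>M MH n"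
proof -
  have [measurable]: "(\<lambda>h. fst h k) \<in> comp.MH n \<rightarrow>\<^sub>M comp.MP" if "k < n" for k
    using that by (intro measurable_compose[OF measurable_fst measurable_component_singleton]) auto
  have "(\<lambda>h. restrict (\<lambda>k. (fst (fst (fst h k)), snd (fst h k))) {..<n}) \<in> comp.MH n \<rightarrow>\<^sub>M MB n"
    by (rule measurable_restrict) auto
  then show ?thesis unfolding drop_run_history_def[abs_def] by measurable
qed

lemma drop_attach_run_history:
  assumes "h \<in> space (MH n)"
  shows "drop_run_history n (attach_run_history n h) = h"
  using assms
  by (cases h) (auto simp: drop_run_history_def attach_run_history_def attach_run_def space_pair_measure
      space_PiM PiE_iff extensional_def fun_eq_iff)

lemma section_at_composition:
  assumes "q \<in> nodes T" shows "section_at (composition D L T) (x, q) = section_at D x"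
  using assms by (auto simp: section_at_def composition_def)

text \<open>The admissible inputs at \<open>(x, q)\<close> are those at \<open>x\<close>, so a policy stays a policy under both
  translations of histories.\<close>

lemma pull_back_policy:
  assumes "\<pi> \<in> policies (composition D L T)"
  shows "(\<lambda>n h. \<pi> n (attach_run_history n h)) \<in> policies D"
  unfolding policies_iff
proof (intro allI conjI ballI)
  fix n
  have "\<pi> n \<in> universal_completion (comp.MH n) \<rightarrow>\<^sub>M prob_algebra MU"
    using comp.policy_measurable[OF assms] by simp
  then show "(\<lambda>h. \<pi> n (attach_run_history n h)) \<in> universal_completion (MH n) \<rightarrow>\<^sub>M prob_algebra MU"
    by (rule measurable_compose[OF measurable_universal_completion[OF attach_run_history_measurable]])
  fix h assume "h \<in> space (MH n)"
  then have a: "attach_run_history n h \<in> space (comp.MH n)"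
    by (rule measurable_space[OF attach_run_history_measurable])
  then have "snd (attach_run_history n h) \<in> space (borel_of (states (composition D L T)))"
    by (auto simp: space_pair_measure)
  then have "run T (trace L (fst h)) n \<in> nodes T"
    by (simp add: attach_run_history_def states_composition)
  then have "section_at (composition D L T) (snd (attach_run_history n h)) = section_at D (snd h)"
    by (simp add: attach_run_history_def section_at_composition)
  moreover have "emeasure (completion (\<pi> n (attach_run_history n h)))
      (section_at (composition D L T) (snd (attach_run_history n h))) = 1"
    using assms a unfolding comp.policies_iff by blast
  ultimately show "emeasure (completion (\<pi> n (attach_run_history n h))) (section_at D (snd h)) = 1"
    by simp
qed

lemma push_forward_policy:
  assumes "\<pi> \<in> policies D"
  shows "(\<lambda>n h. \<pi> n (drop_run_history n h)) \<in> policies (composition D L T)"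
  unfolding comp.policies_iff
proof (intro allI conjI ballI)
  fix n
  show "(\<lambda>h. \<pi> n (drop_run_history n h)) \<in> universal_completion (comp.MH n) \<rightarrow>\<^sub>M
      prob_algebra (borel_of (inputs (composition D L T)))"
    using measurable_compose[OF measurable_universal_completion[OF drop_run_history_measurable]
        policy_measurable[OF assms]] by simp
  fix h assume h: "h \<in> space (comp.MH n)"
  then have a: "drop_run_history n h \<in> space (MH n)"
    by (rule measurable_space[OF drop_run_history_measurable])
  have "snd h \<in> space (borel_of (states (composition D L T)))" using h by (auto simp: space_pair_measure)
  then have "snd (snd h) \<in> nodes T" by (auto simp: states_composition)
  then have "section_at (composition D L T) (snd h) = section_at D (snd (drop_run_history n h))"
    using section_at_composition[of "snd (snd h)" "fst (snd h)"] by (simp add: drop_run_history_def)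
  moreover have "emeasure (completion (\<pi> n (drop_run_history n h)))
      (section_at D (snd (drop_run_history n h))) = 1"
    using assms a unfolding policies_iff by blast
  ultimately show "emeasure (completion (\<pi> n (drop_run_history n h))) (section_at (composition D L T) (snd h)) = 1"
    by simp
qed

lemma emeasure_composed_kernel:
  assumes z: "((x, q), u) \<in> space comp.MP" and C: "C \<in> sets (borel_of (states (composition D L T)))"
  shows "emeasure (kernel (composition D L T) ((x, q), u)) C =
    emeasure (kernel D (x, u)) {y \<in> space MX. (y, trans T q (L x)) \<in> C}"
proof -
  have z': "x \<in> space MX" "q \<in> nodes T" "u \<in> space MU"
    using z by (auto simp: space_pair_measure states_composition)
  have k: "prob_space (kernel D (x, u))" and s [measurable_cong]: "sets (kernel D (x, u)) = sets MX"
    using measurable_space[OF kernel_measurable, of "(x, u)"] z'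
    by (auto simp: space_prob_algebra space_pair_measure)
  have t: "trans T q (L x) \<in> space MQ"
    using deterministic z'(2) label_in_alphabet[OF z'(1)] by (auto simp: deterministic_ts_def)
  have C': "C \<in> sets (kernel D (x, u) \<Otimes>\<^sub>M MQ)"
    using C by (simp add: sets_composed_states sets_pair_measure_cong[OF s refl])
  have "emeasure (kernel (composition D L T) ((x, q), u)) C =
      emeasure (distr (kernel D (x, u)) (kernel D (x, u) \<Otimes>\<^sub>M MQ) (\<lambda>y. (y, trans T q (L x)))) C"
    by (simp add: composition_def pair_measure_return[OF k t])
  also have "\<dots> = emeasure (kernel D (x, u)) {y \<in> space MX. (y, trans T q (L x)) \<in> C}"
    using t C' sets_eq_imp_space_eq[OF s]
    by (subst emeasure_distr) (auto simp: vimage_def Int_def conj_commute)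
  finally show ?thesis .
qed

abbreviation lift_init :: "'x measure \<Rightarrow> ('x \<times> 'q) measure" where
  "lift_init \<alpha> \<equiv> \<alpha> \<Otimes>\<^sub>M return MQ (start T)"

text \<open>The next state of the composition consists of the next state of \<open>D\<close> and a node that the history
  already determines, so its conditional law is the transition kernel of \<open>D\<close> with a point mass
  attached, which is how the composition is defined.\<close>

lemma path_law_attach_run:
  assumes \<alpha>: "\<alpha> \<in> space (prob_algebra MX)"
    and \<pi>: "\<And>n. \<pi> n \<in> universal_completion (comp.MH n) \<rightarrow>\<^sub>M prob_algebra MU"
    and P: "is_path_measure D \<alpha> (\<lambda>n h. \<pi> n (attach_run_history n h)) P"
  shows "is_path_measure (composition D L T) (lift_init \<alpha>) \<pi> (distr P comp.MW attach_run)"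
proof -
  have sP [measurable_cong]: "sets P = sets MW" and spP: "space P = space MW" and pP: "prob_space P"
    using P by (auto simp: is_path_measure_iff dest: sets_eq_imp_space_eq)
  have aw: "attach_run \<omega> \<in> space comp.MW" if "\<omega> \<in> space MW" for \<omega>
    using that by (rule measurable_space[OF attach_run_measurable])
  have attach [measurable]: "attach_run \<in> P \<rightarrow>\<^sub>M comp.MW" by measurable
  have start: "start T \<in> space MQ" using deterministic by (simp add: deterministic_ts_def)
  have em: "emeasure (distr P comp.MW attach_run) {\<omega> \<in> space comp.MW. R \<omega>} =
      emeasure P {\<omega> \<in> space MW. R (attach_run \<omega>)}"
    if "Measurable.pred comp.MW R" for R
    using that aw
    by (subst emeasure_distr[OF attach]) (auto simp: spP intro!: arg_cong[where f = "emeasure P"])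
  show ?thesis
    unfolding comp.is_path_measure_iff
  proof (intro conjI allI ballI)
    show "sets (distr P comp.MW attach_run) = sets comp.MW" by simp
    show "prob_space (distr P comp.MW attach_run)"
      using pP by (rule prob_space.prob_space_distr) measurable
  next
    fix C assume C [measurable]: "C \<in> sets comp.MX"
    have init: "\<And>A. A \<in> sets MX \<Longrightarrow> emeasure P {\<omega> \<in> space MW. fst (\<omega> 0) \<in> A} = emeasure \<alpha> A"
      using P by (simp add: is_path_measure_iff)
    have a: "prob_space \<alpha>" and s [measurable_cong]: "sets \<alpha> = sets MX" using \<alpha> by (auto simp: space_prob_algebra)
    have [measurable]: "{x \<in> space MX. (x, start T) \<in> C} \<in> sets MX"
      using start by measurable
    have "emeasure (lift_init \<alpha>) C = emeasure \<alpha> {x \<in> space MX. (x, start T) \<in> C}"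
      using C start sets_eq_imp_space_eq[OF s] unfolding pair_measure_return[OF a start]
      by (subst emeasure_distr)
        (auto simp: vimage_def Int_def conj_commute sets_composed_states sets_pair_measure_cong[OF s refl])
    also have "\<dots> = emeasure P {\<omega> \<in> space MW. fst (\<omega> 0) \<in> {x \<in> space MX. (x, start T) \<in> C}}"
      by (rule init[symmetric]) measurable
    also have "\<dots> = emeasure P {\<omega> \<in> space MW. fst (attach_run \<omega> 0) \<in> C}"
    proof -
      have "fst (\<omega> 0) \<in> space MX" if "\<omega> \<in> space MW" for \<omega> :: "nat \<Rightarrow> 'x \<times> 'u"
        using PiE_mem[of \<omega> UNIV "\<lambda>_. space MP" 0] that by (auto simp: space_PiM space_pair_measure)
      then show ?thesis
        by (intro arg_cong[where f = "emeasure P"]) (auto simp: attach_run_def)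
    qed
    finally show "emeasure (distr P comp.MW attach_run) {\<omega> \<in> space comp.MW. fst (\<omega> 0) \<in> C} = emeasure (lift_init \<alpha>) C"
      by (subst em) auto
  next
    fix n B C assume B [measurable]: "B \<in> sets (comp.MH n)" and C [measurable]: "C \<in> sets comp.MU"
    let ?P' = "distr P comp.MW attach_run"
    let ?B = "attach_run_history n -` B \<inter> space (MH n)"
    have B': "?B \<in> sets (MH n)" by measurable
    have C': "C \<in> sets MU" using C by simp
    have choice: "\<And>B C. B \<in> sets (MH n) \<Longrightarrow> C \<in> sets MU \<Longrightarrow>
        emeasure P {\<omega> \<in> space MW. history n \<omega> \<in> B \<and> snd (\<omega> n) \<in> C} =
        (\<integral>\<^sup>+\<omega>. emeasure (\<pi> n (attach_run_history n (history n \<omega>))) C * indicator B (history n \<omega>) \<partial>completion P)"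
      using P by (simp add: is_path_measure_iff)
    have h: "history n \<omega> \<in> space (MH n)" if "\<omega> \<in> space MW" for \<omega>
      using that by (rule measurable_space[OF history_measurable])
    have "emeasure ?P' {\<omega> \<in> space comp.MW. history n \<omega> \<in> B \<and> snd (\<omega> n) \<in> C} =
        emeasure P {\<omega> \<in> space MW. history n (attach_run \<omega>) \<in> B \<and> snd (attach_run \<omega> n) \<in> C}"
      by (rule em) measurable
    also have "\<dots> = emeasure P {\<omega> \<in> space MW. history n \<omega> \<in> ?B \<and> snd (\<omega> n) \<in> C}"
      using h by (intro arg_cong[where f = "emeasure P"]) (auto simp: history_attach_run attach_run_def)
    also have "\<dots> = (\<integral>\<^sup>+\<omega>. emeasure (\<pi> n (attach_run_history n (history n \<omega>))) C * indicator ?B (history n \<omega>) \<partial>completion P)"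
      by (rule choice[OF B' C'])
    also have "\<dots> = (\<integral>\<^sup>+\<omega>. emeasure (\<pi> n (history n (attach_run \<omega>))) C * indicator B (history n (attach_run \<omega>)) \<partial>completion P)"
      using h by (intro nn_integral_cong) (auto simp: spP history_attach_run split: split_indicator)
    also have "\<dots> = (\<integral>\<^sup>+\<omega>. emeasure (\<pi> n (history n \<omega>)) C * indicator B (history n \<omega>) \<partial>completion ?P')"
    proof (rule nn_integral_completion_distr)
      show "attach_run \<in> P \<rightarrow>\<^sub>M comp.MW" by (rule attach)
      have "(\<lambda>\<omega>. \<pi> n (history n \<omega>)) \<in> universal_completion comp.MW \<rightarrow>\<^sub>M prob_algebra MU"
        by (rule measurable_compose[OF measurable_universal_completion[OF comp.history_measurable] \<pi>])
      moreover have "?P' \<in> space (prob_algebra comp.MW)"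
        using pP attach by (simp add: space_prob_algebra prob_space.prob_space_distr)
      ultimately have "(\<lambda>\<omega>. \<pi> n (history n \<omega>)) \<in> completion ?P' \<rightarrow>\<^sub>M prob_algebra MU"
        by (rule measurable_universal_completionD)
      then have [measurable]: "(\<lambda>\<omega>. \<pi> n (history n \<omega>)) \<in> completion ?P' \<rightarrow>\<^sub>M subprob_algebra MU"
        by (rule measurable_prob_algebraD)
      have [measurable]: "history n \<in> completion ?P' \<rightarrow>\<^sub>M comp.MH n"
        by (rule measurable_completion, subst measurable_distr_eq1) (rule comp.history_measurable)
      note C' [measurable]
      show "(\<lambda>\<omega>. emeasure (\<pi> n (history n \<omega>)) C * indicator B (history n \<omega>)) \<in> borel_measurable (completion ?P')"
        by measurable
    qed
    finally show "emeasure ?P' {\<omega> \<in> space comp.MW. history n \<omega> \<in> B \<and> snd (\<omega> n) \<in> C} =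
        (\<integral>\<^sup>+\<omega>. emeasure (\<pi> n (history n \<omega>)) C * indicator B (history n \<omega>) \<partial>completion ?P')" .
  next
    fix n B C assume B [measurable]: "B \<in> sets (comp.MH n \<Otimes>\<^sub>M comp.MU)" and C [measurable]: "C \<in> sets comp.MX"
    let ?P' = "distr P comp.MW attach_run"
    define nx where "nx h = trans T (run T (trace L (fst h)) n) (L (snd h))" for h :: "(nat \<Rightarrow> 'x \<times> 'u) \<times> 'x"
    have "(\<lambda>h. (snd h, run T (trace L (fst h)) n)) \<in> MH n \<rightarrow>\<^sub>M MX \<Otimes>\<^sub>M MQ"
      using measurable_compose[OF measurable_fst run_measurable[of n "{..<n}"]] by measurable
    from measurable_compose[OF this next_node_measurable]
    have nx [measurable]: "nx \<in> MH n \<rightarrow>\<^sub>M MQ" by (simp add: nx_def[abs_def])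
    have run_Suc: "run T (trace L \<omega>) (Suc n) = nx (history n \<omega>)" for \<omega> :: "nat \<Rightarrow> 'x \<times> 'u"
      using run_trace_restrict[of n n \<omega>] by (simp add: nx_def history_def trace_def[of L \<omega>])
    \<comment> \<open>Given the history, the next node is \<open>nx h\<close>. On the event that it equals \<open>q\<close>,
      a condition on the next state of the composition is the condition \<open>Cq q\<close>
      on the next state of \<open>D\<close> alone.\<close>
    define Bq where "Bq q = {z \<in> space (MH n \<Otimes>\<^sub>M MU). (attach_run_history n (fst z), snd z) \<in> B \<and> nx (fst z) = q}" for q
    define Cq where "Cq q = {y \<in> space MX. (y, q) \<in> C}" for q
    have single [measurable]: "{q} \<in> sets MQ" if "q \<in> nodes T" for q using that by (simp add: sets_borel_of_discrete)
    have Bq [measurable]: "Bq q \<in> sets (MH n \<Otimes>\<^sub>M MU)" if "q \<in> nodes T" for q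
    proof -
      let ?f = "\<lambda>z. (attach_run_history n (fst z), snd z)"
      have f: "?f \<in> MH n \<Otimes>\<^sub>M MU \<rightarrow>\<^sub>M comp.MH n \<Otimes>\<^sub>M MU" by measurable
      have "B \<in> sets (comp.MH n \<Otimes>\<^sub>M MU)" using B by simp
      from measurable_sets[OF f this]
        measurable_sets[OF measurable_compose[OF measurable_fst nx] single[OF that], of MU]
      have "(?f -` B \<inter> space (MH n \<Otimes>\<^sub>M MU)) \<inter>
          ((\<lambda>z. nx (fst z)) -` {q} \<inter> space (MH n \<Otimes>\<^sub>M MU)) \<in> sets (MH n \<Otimes>\<^sub>M MU)"
        by (rule sets.Int)
      also have "(?f -` B \<inter> space (MH n \<Otimes>\<^sub>M MU)) \<inter>
          ((\<lambda>z. nx (fst z)) -` {q} \<inter> space (MH n \<Otimes>\<^sub>M MU)) = Bq q"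
        by (auto simp: Bq_def)
      finally show ?thesis .
    qed
    have Cq [measurable]: "Cq q \<in> sets MX" if "q \<in> nodes T" for q
    proof -
      have "q \<in> space MQ" using that by simp
      then show ?thesis unfolding Cq_def by measurable
    qed
    define F where "F q = {\<omega> \<in> space MW. (history n \<omega>, snd (\<omega> n)) \<in> Bq q \<and> fst (\<omega> (Suc n)) \<in> Cq q}" for q
    have F: "F q \<in> sets P" if "q \<in> nodes T" for q
      unfolding F_def spP[symmetric] using Bq[OF that] Cq[OF that] by measurable
    have mem: "(history n \<omega>, snd (\<omega> n)) \<in> space (MH n \<Otimes>\<^sub>M MU)" "nx (history n \<omega>) \<in> nodes T"
        "fst (\<omega> m) \<in> space MX" if w: "\<omega> \<in> space MW" for \<omega> m
    proof -
      have *: "history n \<omega> \<in> space (MH n)" by (rule measurable_space[OF history_measurable w])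
      show "nx (history n \<omega>) \<in> nodes T" using measurable_space[OF nx *] by simp
      have "\<omega> k \<in> space MP" for k using w by (auto simp: space_PiM)
      then show "fst (\<omega> m) \<in> space MX" "(history n \<omega>, snd (\<omega> n)) \<in> space (MH n \<Otimes>\<^sub>M MU)"
        using * by (auto simp: space_pair_measure mem_Times_iff)
    qed
    have "emeasure ?P' {\<omega> \<in> space comp.MW. (history n \<omega>, snd (\<omega> n)) \<in> B \<and> fst (\<omega> (Suc n)) \<in> C} =
        emeasure P {\<omega> \<in> space MW. (history n (attach_run \<omega>), snd (attach_run \<omega> n)) \<in> B \<and> fst (attach_run \<omega> (Suc n)) \<in> C}"
      by (rule em) measurable
    also have "{\<omega> \<in> space MW. (history n (attach_run \<omega>), snd (attach_run \<omega> n)) \<in> B \<and> fst (attach_run \<omega> (Suc n)) \<in> C} =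
        (\<Union>q\<in>nodes T. F q)"
      using mem by (auto simp: F_def Bq_def Cq_def history_attach_run attach_run_def run_Suc simp del: run.simps)
    also have "emeasure P (\<Union>q\<in>nodes T. F q) = (\<Sum>q\<in>nodes T. emeasure P (F q))"
      using F deterministic
      by (intro sum_emeasure[symmetric]) (auto simp: disjoint_family_on_def F_def Bq_def deterministic_ts_def)
    also have "\<dots> = (\<Sum>q\<in>nodes T. \<integral>\<^sup>+\<omega>. emeasure (kernel D (\<omega> n)) (Cq q) * indicator (Bq q) (history n \<omega>, snd (\<omega> n)) \<partial>P)"
      using P Bq Cq unfolding F_def by (intro sum.cong refl) (simp add: is_path_measure_iff)
    also have "\<dots> = (\<integral>\<^sup>+\<omega>. (\<Sum>q\<in>nodes T. emeasure (kernel D (\<omega> n)) (Cq q) * indicator (Bq q) (history n \<omega>, snd (\<omega> n))) \<partial>P)"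
    proof (rule nn_integral_sum[symmetric])
      fix q assume q: "q \<in> nodes T"
      have [measurable]: "kernel D \<in> MP \<rightarrow>\<^sub>M subprob_algebra MX"
        by (rule measurable_prob_algebraD[OF kernel_measurable])
      show "(\<lambda>\<omega>. emeasure (kernel D (\<omega> n)) (Cq q) * indicator (Bq q) (history n \<omega>, snd (\<omega> n))) \<in> borel_measurable P"
        using Bq[OF q] Cq[OF q] by measurable
    qed
    also have "\<dots> = (\<integral>\<^sup>+\<omega>. emeasure (kernel (composition D L T) (attach_run \<omega> n)) C *
        indicator B (history n (attach_run \<omega>), snd (attach_run \<omega> n)) \<partial>P)"
    proof (rule nn_integral_cong)
      fix \<omega> assume "\<omega> \<in> space P"
      then have w: "\<omega> \<in> space MW" by (simp add: spP)
      have ind: "indicator (Bq q) (history n \<omega>, snd (\<omega> n)) = (if q = nx (history n \<omega>)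
          then indicator B (history n (attach_run \<omega>), snd (attach_run \<omega> n)) else (0 :: ennreal))" for q
        using mem(1)[OF w] by (auto simp: Bq_def history_attach_run attach_run_def split: split_indicator)
      have "attach_run \<omega> n \<in> space comp.MP" using aw[OF w] by (auto simp: space_PiM)
      then have "emeasure (kernel (composition D L T) (attach_run \<omega> n)) C =
          emeasure (kernel D (\<omega> n)) {y \<in> space MX. (y, trans T (run T (trace L \<omega>) n) (L (fst (\<omega> n)))) \<in> C}"
        using emeasure_composed_kernel[OF _ C, of "fst (\<omega> n)" "run T (trace L \<omega>) n" "snd (\<omega> n)"]
        by (simp add: attach_run_def)
      also have "trans T (run T (trace L \<omega>) n) (L (fst (\<omega> n))) = nx (history n \<omega>)"
        using run_Suc[of \<omega>] by (simp add: trace_def)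
      finally have k: "emeasure (kernel (composition D L T) (attach_run \<omega> n)) C =
          emeasure (kernel D (\<omega> n)) (Cq (nx (history n \<omega>)))" by (simp add: Cq_def)
      have "(\<Sum>q\<in>nodes T. emeasure (kernel D (\<omega> n)) (Cq q) * indicator (Bq q) (history n \<omega>, snd (\<omega> n))) =
          (\<Sum>q\<in>nodes T. if q = nx (history n \<omega>) then emeasure (kernel D (\<omega> n)) (Cq q) *
            indicator B (history n (attach_run \<omega>), snd (attach_run \<omega> n)) else 0)"
        by (intro sum.cong) (auto simp: ind)
      also have "\<dots> = emeasure (kernel (composition D L T) (attach_run \<omega> n)) C *
          indicator B (history n (attach_run \<omega>), snd (attach_run \<omega> n))"
        using mem(2)[OF w] deterministic by (simp add: k deterministic_ts_def)
      finally show "(\<Sum>q\<in>nodes T. emeasure (kernel D (\<omega> n)) (Cq q) * indicator (Bq q) (history n \<omega>, snd (\<omega> n))) =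
          emeasure (kernel (composition D L T) (attach_run \<omega> n)) C *
          indicator B (history n (attach_run \<omega>), snd (attach_run \<omega> n))" .
    qed
    also have "\<dots> = (\<integral>\<^sup>+\<omega>. emeasure (kernel (composition D L T) (\<omega> n)) C * indicator B (history n \<omega>, snd (\<omega> n)) \<partial>?P')"
    proof -
      have [measurable]: "kernel (composition D L T) \<in> comp.MP \<rightarrow>\<^sub>M subprob_algebra comp.MX"
        by (rule measurable_prob_algebraD[OF comp.kernel_measurable])
      have "(\<lambda>\<omega>. emeasure (kernel (composition D L T) (\<omega> n)) C * indicator B (history n \<omega>, snd (\<omega> n))) \<in> borel_measurable comp.MW"
        by measurable
      then show ?thesis by (subst nn_integral_distr[OF attach]) simp_all
    qed
    finally show "emeasure ?P' {\<omega> \<in> space comp.MW. (history n \<omega>, snd (\<omega> n)) \<in> B \<and> fst (\<omega> (Suc n)) \<in> C} =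
        (\<integral>\<^sup>+\<omega>. emeasure (kernel (composition D L T) (\<omega> n)) C * indicator B (history n \<omega>, snd (\<omega> n)) \<partial>?P')" .
  qed
qed

lemma composed_acceptance_measurable:
  assumes "Acc \<in> sets (borel_of (product_topology (\<lambda>_. discrete_topology (nodes T)) UNIV))"
  shows "composed_acceptance D L T Acc \<in> sets comp.MW"
proof -
  have [measurable]: "Acc \<in> sets (PiM UNIV (\<lambda>_::nat. MQ))"
    using assms sets_borel_of_product_topology[OF second_countable_nodes, of "UNIV :: nat set"] by simp
  have "(\<lambda>\<omega>. \<lambda>n\<in>UNIV. snd (fst (\<omega> n))) \<in> comp.MW \<rightarrow>\<^sub>M PiM UNIV (\<lambda>_::nat. MQ)"
    by (rule measurable_restrict) measurable
  then have [measurable]: "(\<lambda>\<omega> n. snd (fst (\<omega> n))) \<in> comp.MW \<rightarrow>\<^sub>M PiM UNIV (\<lambda>_::nat. MQ)"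
    by (simp add: restrict_def)
  show ?thesis unfolding composed_acceptance_def comp.topspace_path_space by measurable
qed

lemma attach_run_acceptance:
  "attach_run -` composed_acceptance D L T Acc \<inter> space MW = accepted_paths D L T Acc"
proof -
  have "trace L \<omega> n \<in> alphabet T" if "\<omega> \<in> space MW" for \<omega> n
  proof -
    have "\<omega> n \<in> space MP" using that by (auto simp: space_PiM)
    then show ?thesis using label_in_alphabet by (auto simp: trace_def space_pair_measure)
  qed
  then show ?thesis
    using measurable_space[OF attach_run_measurable]
    by (auto simp: composed_acceptance_def accepted_paths_def language_def topspace_path_space
        comp.topspace_path_space attach_run_def)
qed

lemma emeasure_composed_path_measure:
  assumes \<alpha>: "\<alpha> \<in> space (prob_algebra MX)" and \<pi>: "\<pi> \<in> policies (composition D L T)"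
    and Acc: "Acc \<in> sets (borel_of (product_topology (\<lambda>_. discrete_topology (nodes T)) UNIV))"
  shows "emeasure (path_measure (composition D L T) (lift_init \<alpha>) \<pi>) (composed_acceptance D L T Acc) =
    emeasure (path_measure D \<alpha> (\<lambda>n h. \<pi> n (attach_run_history n h))) (accepted_paths D L T Acc)"
proof -
  let ?P = "path_measure D \<alpha> (\<lambda>n h. \<pi> n (attach_run_history n h))"
  have P: "is_path_measure D \<alpha> (\<lambda>n h. \<pi> n (attach_run_history n h)) ?P"
    by (rule is_path_measure_path_measure[OF pull_back_policy[OF \<pi>] \<alpha>])
  have sP [measurable_cong]: "sets ?P = sets MW" and spP: "space ?P = space MW"
    using P by (auto simp: is_path_measure_iff dest: sets_eq_imp_space_eq)
  have "is_path_measure (composition D L T) (lift_init \<alpha>) \<pi> (distr ?P comp.MW attach_run)"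
    using comp.policy_measurable[OF \<pi>] by (intro path_law_attach_run[OF \<alpha> _ P]) simp
  then have "path_measure (composition D L T) (lift_init \<alpha>) \<pi> = distr ?P comp.MW attach_run"
    by (rule comp.path_measure_eqI[OF \<pi>])
  moreover have "attach_run \<in> ?P \<rightarrow>\<^sub>M comp.MW" by measurable
  ultimately show ?thesis
    using composed_acceptance_measurable[OF Acc]
    by (simp only: emeasure_distr spP attach_run_acceptance)
qed

text \<open>Pulling back maps the policies of the composition onto those of \<open>D\<close>, up to their values outside
  the history spaces, and preserves the probability in question.\<close>

lemma attained_values_composition:
  assumes \<alpha>: "\<alpha> \<in> space (prob_algebra MX)"
    and Acc: "Acc \<in> sets (borel_of (product_topology (\<lambda>_. discrete_topology (nodes T)) UNIV))"
  shows "(\<lambda>\<pi>. emeasure (path_measure D \<alpha> \<pi>) (accepted_paths D L T Acc)) ` policies D =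
    (\<lambda>\<pi>. emeasure (path_measure (composition D L T) (lift_init \<alpha>) \<pi>) (composed_acceptance D L T Acc)) `
      policies (composition D L T)" (is "?A = ?B")
proof
  show "?B \<subseteq> ?A"
    using emeasure_composed_path_measure[OF \<alpha> _ Acc] pull_back_policy by (auto intro!: image_eqI)
  show "?A \<subseteq> ?B"
  proof
    fix v assume "v \<in> ?A"
    then obtain \<pi> where \<pi>: "\<pi> \<in> policies D"
      and v: "v = emeasure (path_measure D \<alpha> \<pi>) (accepted_paths D L T Acc)" by auto
    have "path_measure D \<alpha> \<pi> = path_measure D \<alpha> (\<lambda>n h. \<pi> n (drop_run_history n (attach_run_history n h)))"
      by (rule path_measure_cong) (simp add: drop_attach_run_history)
    then show "v \<in> ?B"
      using emeasure_composed_path_measure[OF \<alpha> push_forward_policy[OF \<pi>] Acc] v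
      by (intro image_eqI[OF _ push_forward_policy[OF \<pi>]]) simp
  qed
qed

end

theorem theorem1:
  fixes D :: "('x, 'u) mp" and L :: "'x \<Rightarrow> 's" and T :: "('q, 's) dts"
    and Acc :: "(nat \<Rightarrow> 'q) set" and \<alpha> :: "'x measure"
  assumes "cdt_mp D"
    and "omega_automaton T Acc"
    and "L \<in> borel_of (states D) \<rightarrow>\<^sub>M borel_of (discrete_topology (alphabet T))"
    and "\<alpha> \<in> space (prob_algebra (borel_of (states D)))"
  shows "M_sup D \<alpha> (accepted_paths D L T Acc) =
           M_sup (composition D L T)
             (\<alpha> \<Otimes>\<^sub>M return (borel_of (discrete_topology (nodes T))) (start T))
             (composed_acceptance D L T Acc)
       \<and> M_inf D \<alpha> (accepted_paths D L T Acc) =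
           M_inf (composition D L T)
             (\<alpha> \<Otimes>\<^sub>M return (borel_of (discrete_topology (nodes T))) (start T))
             (composed_acceptance D L T Acc)"
proof -
  interpret composed_mp D L T
    using assms(1-3)
    by unfold_locales (auto simp: cdt_mp_def omega_automaton_def intro: second_countable_borel_space)
  have "Acc \<in> sets (borel_of (product_topology (\<lambda>_. discrete_topology (nodes T)) UNIV))"
    using assms(2) by (simp add: omega_automaton_def)
  from attained_values_composition[OF assms(4) this] show ?thesis
    by (simp add: M_sup_def M_inf_def)
qed

end
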